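(* Consider $\min\{c^Tx: Ax=b, x\ge0\}$ and its dual $\max\{b^Ty: A^Ty+s=c, s\ge0\}$ for the node-arc incidence matrix $A$ of a directed graph with $n$ nodes and $m$ arcs. Given interior primal and dual points ($x>0$, $Ax=b$; $s>0$, $A^Ty+s=c$) with potential $P(x,s)=P_0$, there is a combinatorial algorithm that outputs interior primal and dual solutions $x$ and $y,s$ with $x^Ts<1$ in time $O\big(P_0\cdot \mathrm{CEF}(n,m,1/(16q^2))\big)$, where $q=m+\min\{k\in\mathbb{Z}: k^2\ge m\}$.
   Context: Potential: $P(x,s)=q\ln(x^Ts)-\sum_a\ln(x_as_a)-m\ln m$. Electrical flows: for resistances $r\in\mathbb{Q}^m_{\ge0}$, $R=\operatorname{diag}(r)$, $\|v\|_R=\sqrt{v^TRv}$, and current sources $\chi\in\mathbb{Q}^n$ with $\mathbf{1}^T\chi=0$, the electrical flow $f^*$ is the minimizer of $\|f\|_R^2$ subject to $Af=\chi$; an $\varepsilon$-electrical flow is $f$ with $Af=\chi$ and $\|f\|_R^2\le(1+\varepsilon)\|f^*\|_R^2$. The dual problem is $\max\{2\pi^T\chi-\pi^TAR^{-1}A^T\pi\}$ with optimum $\pi^*$. A certifying $\varepsilon$-electrical flow algorithm computes an $\varepsilon$-electrical flow $f$ and voltages $\pi\in\mathbb{Q}^n$ with $\|\pi-\pi^*\|^2_{AR^{-1}A^T}\le\varepsilon\|\pi^*\|^2_{AR^{-1}A^T}$ (where $\|v\|_M^2=v^TMv$). $\mathrm{CEF}(n,m,\varepsilon)$ is a bound on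 the running time of a certifying $\varepsilon$-electrical flow algorithm on directed graphs with $n$ nodes and $m$ arcs. Combinatorial means using only rational arithmetic (addition, subtraction, multiplication, division) and comparisons.
   Formalization: The time bound is O(max{1,P₀}·CEF(n,m,1/(16q²))), since O(P₀·CEF) fails for P₀ near or below 0 (e.g. m=1, xs=1); the minimum in q is over nonnegative k, as none exists over all integers; and m ≥ 1, since 1/(16q²) is undefined for m=0. *)

theory Defs
  imports Complex_Main "Jordan_Normal_Form.Matrix" "Graph_Theory.Digraph"
begin

section \<open>Combinatorial algorithms\<close>

text \<open>
  A combinatorial algorithm is a program of a while language whose memory consists of arrays of
  rationals (array name, index). Numbers are only combined by the four rational operations and
  compared. Every operation, memory access, constant and command costs one time unit, whatever the
  size of the numbers involved.
\<close>

type_synonym store = "nat \<Rightarrow> nat \<Rightarrow> rat"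

datatype exp =
    Num rat
  | Cell nat exp
  | Add exp exp
  | Sub exp exp
  | Mul exp exp
  | Div exp exp

text \<open>
  An index that is not a natural number and a division by zero are errors, with no value. In
  particular, addressing an array cannot be used to round a number or to test it for being integral.
\<close>

fun eval :: "exp \<Rightarrow> store \<Rightarrow> rat option" where
  "eval (Num q) \<sigma> = Some q"
| "eval (Cell a e) \<sigma> =
     (case eval e \<sigma> of
        None \<Rightarrow> None
      | Some v \<Rightarrow> if v \<in> \<nat> then Some (\<sigma> a (nat \<lfloor>v\<rfloor>)) else None)"
| "eval (Add e1 e2) \<sigma> =
     (case (eval e1 \<sigma>, eval e2 \<sigma>) of (Some v, Some w) \<Rightarrow> Some (v + w) | _ \<Rightarrow> None)"
| "eval (Sub e1 e2) \<sigma> =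
     (case (eval e1 \<sigma>, eval e2 \<sigma>) of (Some v, Some w) \<Rightarrow> Some (v - w) | _ \<Rightarrow> None)"
| "eval (Mul e1 e2) \<sigma> =
     (case (eval e1 \<sigma>, eval e2 \<sigma>) of (Some v, Some w) \<Rightarrow> Some (v * w) | _ \<Rightarrow> None)"
| "eval (Div e1 e2) \<sigma> =
     (case (eval e1 \<sigma>, eval e2 \<sigma>) of
        (Some v, Some w) \<Rightarrow> if w = 0 then None else Some (v / w)
      | _ \<Rightarrow> None)"

fun cost :: "exp \<Rightarrow> nat" where
  "cost (Num q) = 1"
| "cost (Cell a e) = 1 + cost e"
| "cost (Add e1 e2) = 1 + cost e1 + cost e2"
| "cost (Sub e1 e2) = 1 + cost e1 + cost e2"
| "cost (Mul e1 e2) = 1 + cost e1 + cost e2"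
| "cost (Div e1 e2) = 1 + cost e1 + cost e2"

text \<open>
  \<open>Assign a i e\<close> is \<open>a[i] := e\<close>, and \<open>New a\<close> binds the name \<open>a\<close> to a freshly allocated array, which
  is zero as all unused memory is. The conditional and the loop test \<open>e1 < e2\<close>; the other
  comparisons are obtained by exchanging the operands or the branches.
\<close>

datatype com =
    Skip
  | Assign nat exp exp
  | New nat
  | Seq com com
  | IfLess exp exp com com
  | WhileLess exp exp com

inductive exec :: "com \<Rightarrow> store \<Rightarrow> nat \<Rightarrow> store \<Rightarrow> bool" where
  Skip: "exec Skip \<sigma> 1 \<sigma>"
| Assign: "\<lbrakk>eval i \<sigma> = Some (of_nat k); eval e \<sigma> = Some v\<rbrakk>
    \<Longrightarrow> exec (Assign a i e) \<sigma> (1 + cost i + cost e) (\<sigma>(a := (\<sigma> a)(k := v)))"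
| New: "exec (New a) \<sigma> 1 (\<sigma>(a := (\<lambda>_. 0)))"
| Seq: "\<lbrakk>exec c1 \<sigma>1 t1 \<sigma>2; exec c2 \<sigma>2 t2 \<sigma>3\<rbrakk> \<Longrightarrow> exec (Seq c1 c2) \<sigma>1 (t1 + t2) \<sigma>3"
| IfTrue: "\<lbrakk>eval e1 \<sigma> = Some v; eval e2 \<sigma> = Some w; v < w; exec c1 \<sigma> t \<sigma>'\<rbrakk>
    \<Longrightarrow> exec (IfLess e1 e2 c1 c2) \<sigma> (1 + cost e1 + cost e2 + t) \<sigma>'"
| IfFalse: "\<lbrakk>eval e1 \<sigma> = Some v; eval e2 \<sigma> = Some w; \<not> v < w; exec c2 \<sigma> t \<sigma>'\<rbrakk>
    \<Longrightarrow> exec (IfLess e1 e2 c1 c2) \<sigma> (1 + cost e1 + cost e2 + t) \<sigma>'"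
| WhileFalse: "\<lbrakk>eval e1 \<sigma> = Some v; eval e2 \<sigma> = Some w; \<not> v < w\<rbrakk>
    \<Longrightarrow> exec (WhileLess e1 e2 c) \<sigma> (1 + cost e1 + cost e2) \<sigma>"
| WhileTrue: "\<lbrakk>eval e1 \<sigma>1 = Some v; eval e2 \<sigma>1 = Some w; v < w;
      exec c \<sigma>1 t1 \<sigma>2; exec (WhileLess e1 e2 c) \<sigma>2 t2 \<sigma>3\<rbrakk>
    \<Longrightarrow> exec (WhileLess e1 e2 c) \<sigma>1 (1 + cost e1 + cost e2 + t1 + t2) \<sigma>3"

text \<open>
  The input is loaded into array 0 of an otherwise zero memory and the output is taken from array 1.
  Loading and unloading a number also takes one time unit, so the running time is at least the size
  of the input and the output.
\<close>

definition initial_store :: "rat list \<Rightarrow> store" where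
  "initial_store ins = (\<lambda>a i. if a = 0 \<and> i < length ins then ins ! i else 0)"

definition computes_in_time :: "com \<Rightarrow> rat list \<Rightarrow> rat list \<Rightarrow> nat \<Rightarrow> bool" where
  "computes_in_time p ins outs t \<longleftrightarrow>
     (\<exists>k \<sigma>. exec p (initial_store ins) k \<sigma> \<and>
            outs = map (\<sigma> 1) [0..<length outs] \<and>
            t = k + length ins + length outs)"

section \<open>Graphs and the minimum cost flow problem\<close>

text \<open>Nodes and arcs are numbered, so that a graph can be given to a program.\<close>

definition numbered_digraph :: "nat \<Rightarrow> nat \<Rightarrow> (nat, nat) pre_digraph \<Rightarrow> bool" where
  "numbered_digraph n m G \<longleftrightarrow> fin_digraph G \<and> verts G = {..<n} \<and> arcs G = {..<m}"

definition encode_digraph :: "nat \<Rightarrow> nat \<Rightarrow> (nat, nat) pre_digraph \<Rightarrow> rat list" where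
  "encode_digraph n m G =
     [of_nat n, of_nat m] @ map (\<lambda>a. of_nat (tail G a)) [0..<m]
       @ map (\<lambda>a. of_nat (head G a)) [0..<m]"

definition incidence_mat :: "nat \<Rightarrow> nat \<Rightarrow> (nat, nat) pre_digraph \<Rightarrow> 'a::ring_1 mat" where
  "incidence_mat n m G =
     mat n m (\<lambda>(v, a). (if head G a = v then 1 else 0) - (if tail G a = v then 1 else 0))"

definition interior_primal :: "'a::linordered_field mat \<Rightarrow> 'a vec \<Rightarrow> 'a vec \<Rightarrow> bool" where
  "interior_primal A b x \<longleftrightarrow>
     x \<in> carrier_vec (dim_col A) \<and> A *\<^sub>v x = b \<and> (\<forall>a < dim_col A. x $ a > 0)"

definition interior_dual ::
    "'a::linordered_field mat \<Rightarrow> 'a vec \<Rightarrow> 'a vec \<Rightarrow> 'a vec \<Rightarrow> bool" where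
  "interior_dual A c y s \<longleftrightarrow>
     y \<in> carrier_vec (dim_row A) \<and> s \<in> carrier_vec (dim_col A) \<and>
     A\<^sup>T *\<^sub>v y + s = c \<and> (\<forall>a < dim_col A. s $ a > 0)"

definition potential_parameter :: "nat \<Rightarrow> nat" where
  "potential_parameter m = m + (LEAST k. k\<^sup>2 \<ge> m)"

definition potential :: "nat \<Rightarrow> real vec \<Rightarrow> real vec \<Rightarrow> real" where
  "potential m x s =
     real (potential_parameter m) * ln (x \<bullet> s) - (\<Sum>a<m. ln (x $ a * s $ a)) - real m * ln (real m)"

abbreviation real_vec :: "rat vec \<Rightarrow> real vec" where
  "real_vec \<equiv> map_vec real_of_rat"

section \<open>Electrical flows\<close>

definition sq_norm_wrt :: "real mat \<Rightarrow> real vec \<Rightarrow> real" where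
  "sq_norm_wrt M v = v \<bullet> (M *\<^sub>v v)"

definition resistance_mat :: "real vec \<Rightarrow> real mat" where
  "resistance_mat r = mat_diag (dim_vec r) (\<lambda>a. r $ a)"

definition conductance_mat :: "real vec \<Rightarrow> real mat" where
  "conductance_mat r = mat_diag (dim_vec r) (\<lambda>a. inverse (r $ a))"

definition electrical_flow :: "real mat \<Rightarrow> real vec \<Rightarrow> real vec \<Rightarrow> real vec \<Rightarrow> bool" where
  "electrical_flow A r \<chi> f \<longleftrightarrow>
     f \<in> carrier_vec (dim_col A) \<and> A *\<^sub>v f = \<chi> \<and>
     (\<forall>g \<in> carrier_vec (dim_col A). A *\<^sub>v g = \<chi> \<longrightarrow>
        sq_norm_wrt (resistance_mat r) f \<le> sq_norm_wrt (resistance_mat r) g)"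

definition eps_electrical_flow ::
    "real \<Rightarrow> real mat \<Rightarrow> real vec \<Rightarrow> real vec \<Rightarrow> real vec \<Rightarrow> bool" where
  "eps_electrical_flow \<epsilon> A r \<chi> f \<longleftrightarrow>
     f \<in> carrier_vec (dim_col A) \<and> A *\<^sub>v f = \<chi> \<and>
     (\<exists>f_opt. electrical_flow A r \<chi> f_opt \<and>
        sq_norm_wrt (resistance_mat r) f \<le> (1 + \<epsilon>) * sq_norm_wrt (resistance_mat r) f_opt)"

definition weighted_laplacian :: "real mat \<Rightarrow> real vec \<Rightarrow> real mat" where
  "weighted_laplacian A r = A * conductance_mat r * A\<^sup>T"

definition dual_objective :: "real mat \<Rightarrow> real vec \<Rightarrow> real vec \<Rightarrow> real vec \<Rightarrow> real" where
  "dual_objective A r \<chi> \<pi> = 2 * (\<pi> \<bullet> \<chi>) - \<pi> \<bullet> (weighted_laplacian A r *\<^sub>v \<pi>)"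

definition optimal_voltages :: "real mat \<Rightarrow> real vec \<Rightarrow> real vec \<Rightarrow> real vec \<Rightarrow> bool" where
  "optimal_voltages A r \<chi> \<pi> \<longleftrightarrow>
     \<pi> \<in> carrier_vec (dim_row A) \<and>
     (\<forall>\<rho> \<in> carrier_vec (dim_row A). dual_objective A r \<chi> \<rho> \<le> dual_objective A r \<chi> \<pi>)"

text \<open>
  Optimal voltages are unique up to the kernel of \<open>A\<^sup>T\<close>, on which the norm below vanishes, so it does
  not matter which of them is taken.
\<close>

definition eps_voltages ::
    "real \<Rightarrow> real mat \<Rightarrow> real vec \<Rightarrow> real vec \<Rightarrow> real vec \<Rightarrow> bool" where
  "eps_voltages \<epsilon> A r \<chi> \<pi> \<longleftrightarrow>
     \<pi> \<in> carrier_vec (dim_row A) \<and>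
     (\<exists>\<pi>_opt. optimal_voltages A r \<chi> \<pi>_opt \<and>
        sq_norm_wrt (weighted_laplacian A r) (\<pi> - \<pi>_opt)
          \<le> \<epsilon> * sq_norm_wrt (weighted_laplacian A r) \<pi>_opt)"

text \<open>
  The resistances are nonzero because the dual problem involves their inverses. If the graph is not
  connected, currents that sum up to zero need not admit a flow, hence the last condition.
\<close>

definition electrical_instance ::
    "nat \<Rightarrow> nat \<Rightarrow> (nat, nat) pre_digraph \<Rightarrow> rat vec \<Rightarrow> rat vec \<Rightarrow> bool" where
  "electrical_instance n m G r \<chi> \<longleftrightarrow>
     numbered_digraph n m G \<and>
     r \<in> carrier_vec m \<and> (\<forall>a<m. r $ a > 0) \<and>
     \<chi> \<in> carrier_vec n \<and> (\<Sum>v<n. \<chi> $ v) = 0 \<and>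
     (\<exists>f \<in> carrier_vec m. incidence_mat n m G *\<^sub>v f = real_vec \<chi>)"

text \<open>
  \<open>E\<close> is a certifying electrical flow algorithm, which is given the precision \<open>\<epsilon>\<close> with the instance,
  and \<open>CEF n m \<epsilon>\<close> bounds its running time.
\<close>

definition certifying_electrical_flow_algorithm ::
    "com \<Rightarrow> (nat \<Rightarrow> nat \<Rightarrow> rat \<Rightarrow> real) \<Rightarrow> bool" where
  "certifying_electrical_flow_algorithm E CEF \<longleftrightarrow>
     (\<forall>n m G r \<chi> \<epsilon>. electrical_instance n m G r \<chi> \<and> \<epsilon> > 0 \<longrightarrow>
        (\<exists>f \<pi> t.
           computes_in_time E
             (encode_digraph n m G @ list_of_vec r @ list_of_vec \<chi> @ [\<epsilon>])
             (list_of_vec f @ list_of_vec \<pi>) t \<and>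
           eps_electrical_flow (real_of_rat \<epsilon>) (incidence_mat n m G)
             (real_vec r) (real_vec \<chi>) (real_vec f) \<and>
           eps_voltages (real_of_rat \<epsilon>) (incidence_mat n m G)
             (real_vec r) (real_vec \<chi>) (real_vec \<pi>) \<and>
           real t \<le> CEF n m \<epsilon>))"

end

theory Submission
  imports Defs
begin

text \<open>
  Let \<open>\<Delta> = x\<^sup>T s\<close>, let \<open>g = (q / \<Delta>) X s - 1\<close> be the scaled gradient of the potential, and call the
  electrical flow algorithm with resistances \<open>1 / x\<^sub>a\<^sup>2\<close> and currents \<open>A X g\<close>. For the exact voltages,
  \<open>p = X A\<^sup>T \<pi>\<close> is the orthogonal projection of \<open>g\<close> onto the row space of \<open>A X\<close>, and \<open>X\<^sup>-\<^sup>1 f = p\<close>. As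
  \<open>\<parallel>g\<parallel> \<le> q\<close>, the precision \<open>1 / (16 q\<^sup>2)\<close> makes both \<open>X\<^sup>-\<^sup>1 f\<close> and \<open>X A\<^sup>T \<pi>\<close> wrong by at most
  \<open>1 / 4\<close>. If \<open>g - X A\<^sup>T \<pi>\<close> is not small, then \<open>g - X\<^sup>-\<^sup>1 f\<close>, which is a circulation after scaling, is
  a descent direction for a primal step. If it is small, the dual slacks \<open>s - (\<Delta> / q) A\<^sup>T \<pi>\<close> nearly
  satisfy \<open>x\<^sub>a s\<^sub>a = \<Delta> / q\<close>, and moving there decreases the potential. Either way the decrease is
  at least a constant, while \<open>x\<^sup>T s \<ge> 1\<close> forces the potential to be nonnegative; so there are
  \<open>O(P\<^sub>0)\<close> iterations. Apart from the call, an iteration takes time \<open>O(n + m)\<close>, which is less than the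
  time for reading the input of the call.
\<close>

section \<open>Programs: which arrays matter to them, and how long they run\<close>

section \<open>Running programs\<close>

text \<open>The surplus k = q - m does two jobs. By the inequality of the means the potential is at
  least k ln (x^T s), which links the stopping rule to the potential; and since k^2 \<ge> m, a gap
  that shrinks by a relative amount of order k / q gains a constant when weighted by k, which is
  what a nearly central point offers. Only rational operations are allowed, so norms are compared
  squared and the primal step length has no square root in it. The case distinction has to be
  decidable by the program, hence it tests the computed voltages and not the unknown projection, and
  the threshold must leave room for the errors of both outputs of the call. The second difficulty is
  to run an arbitrary program inside another one. It is specified only for a memory that is zero
  apart from its input, and nothing is known about what earlier calls left behind; so the caller
  keeps its data in arrays that the subroutine cannot name and reallocates all others before each
  call, at a cost that depends on the program only.\<close>

fun exp_names :: "exp \<Rightarrow> nat set" where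
  "exp_names (Num q) = {}"
| "exp_names (Cell a e) = insert a (exp_names e)"
| "exp_names (Add e1 e2) = exp_names e1 \<union> exp_names e2"
| "exp_names (Sub e1 e2) = exp_names e1 \<union> exp_names e2"
| "exp_names (Mul e1 e2) = exp_names e1 \<union> exp_names e2"
| "exp_names (Div e1 e2) = exp_names e1 \<union> exp_names e2"

fun com_names :: "com \<Rightarrow> nat set" where
  "com_names Skip = {}"
| "com_names (Assign a i e) = insert a (exp_names i \<union> exp_names e)"
| "com_names (New a) = {a}"
| "com_names (Seq c1 c2) = com_names c1 \<union> com_names c2"
| "com_names (IfLess e1 e2 c1 c2) = exp_names e1 \<union> exp_names e2 \<union> com_names c1 \<union> com_names c2"
| "com_names (WhileLess e1 e2 c) = exp_names e1 \<union> exp_names e2 \<union> com_names c"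

fun written_names :: "com \<Rightarrow> nat set" where
  "written_names Skip = {}"
| "written_names (Assign a i e) = {a}"
| "written_names (New a) = {a}"
| "written_names (Seq c1 c2) = written_names c1 \<union> written_names c2"
| "written_names (IfLess e1 e2 c1 c2) = written_names c1 \<union> written_names c2"
| "written_names (WhileLess e1 e2 c) = written_names c"

lemma finite_com_names: "finite (com_names c)"
proof -
  have "finite (exp_names e)" for e by (induction e) auto
  then show ?thesis by (induction c) auto
qed

lemma eval_cong: "\<forall>a \<in> exp_names e. \<sigma> a = \<tau> a \<Longrightarrow> eval e \<sigma> = eval e \<tau>"
  by (induction e) (auto split: option.splits)

lemma eval_agree: "eval e \<sigma> = u \<Longrightarrow> exp_names e \<subseteq> A \<Longrightarrow> \<forall>a \<in> A. \<sigma> a = \<tau> a \<Longrightarrow> eval e \<tau> = u"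
  using eval_cong[of e \<sigma> \<tau>] by (simp add: subset_iff)

lemma exec_frame: "exec c \<sigma> t \<sigma>' \<Longrightarrow> a \<notin> written_names c \<Longrightarrow> \<sigma>' a = \<sigma> a"
  by (induction rule: exec.induct) auto

lemma written_names_subset: "written_names c \<subseteq> com_names c"
  by (induction c) auto

text \<open>A command can neither inspect nor change an array that it does not name, so a run
  transfers, with the same time, to a memory holding further data. \<open>A\<close> may exceed the
  names of \<open>c\<close>: it stays fixed while the induction descends to subcommands.\<close>

lemma exec_agree:
  assumes "exec c \<sigma> t \<sigma>'" "com_names c \<subseteq> A" "\<forall>a \<in> A. \<sigma> a = \<tau> a"
  shows "\<exists>\<tau>'. exec c \<tau> t \<tau>' \<and> (\<forall>a \<in> A. \<sigma>' a = \<tau>' a)"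
  using assms
proof (induction arbitrary: \<tau> rule: exec.induct)
  case (Skip \<sigma>)
  then show ?case using exec.Skip by blast
next
  case (Assign i \<sigma> k e v a)
  have "eval i \<tau> = Some (of_nat k)" "eval e \<tau> = Some v"
    using eval_agree[OF Assign.hyps(1) _ Assign.prems(2)] eval_agree[OF Assign.hyps(2) _ Assign.prems(2)]
      Assign.prems(1) by simp_all
  from exec.Assign[OF this, of a] Assign.prems(2) show ?case by (intro exI conjI) auto
next
  case (New a \<sigma>)
  then show ?case using exec.New[of a \<tau>] by (intro exI conjI) auto
next
  case (Seq c1 \<sigma>1 t1 \<sigma>2 c2 t2 \<sigma>3)
  have sub: "com_names c1 \<subseteq> A" "com_names c2 \<subseteq> A" using Seq.prems(1) by simp_all
  from Seq.IH(1)[OF sub(1) Seq.prems(2)] obtain \<tau>2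
    where 1: "exec c1 \<tau> t1 \<tau>2" "\<forall>a \<in> A. \<sigma>2 a = \<tau>2 a" by blast
  from Seq.IH(2)[OF sub(2) 1(2)] obtain \<tau>3
    where 2: "exec c2 \<tau>2 t2 \<tau>3" "\<forall>a \<in> A. \<sigma>3 a = \<tau>3 a" by blast
  from exec.Seq[OF 1(1) 2(1)] 2(2) show ?case by blast
next
  case (IfTrue e1 \<sigma> v e2 w c1 t \<sigma>' c2)
  have ev: "eval e1 \<tau> = Some v" "eval e2 \<tau> = Some w"
    using eval_agree[OF IfTrue.hyps(1) _ IfTrue.prems(2)] eval_agree[OF IfTrue.hyps(2) _ IfTrue.prems(2)]
      IfTrue.prems(1) by simp_all
  have "com_names c1 \<subseteq> A" using IfTrue.prems(1) by simp
  from IfTrue.IH[OF this IfTrue.prems(2)] obtain \<tau>'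
    where \<tau>': "exec c1 \<tau> t \<tau>'" "\<forall>a \<in> A. \<sigma>' a = \<tau>' a" by blast
  from exec.IfTrue[OF ev IfTrue.hyps(3) \<tau>'(1)] \<tau>'(2) show ?case by blast
next
  case (IfFalse e1 \<sigma> v e2 w c2 t \<sigma>' c1)
  have ev: "eval e1 \<tau> = Some v" "eval e2 \<tau> = Some w"
    using eval_agree[OF IfFalse.hyps(1) _ IfFalse.prems(2)] eval_agree[OF IfFalse.hyps(2) _ IfFalse.prems(2)]
      IfFalse.prems(1) by simp_all
  have "com_names c2 \<subseteq> A" using IfFalse.prems(1) by simp
  from IfFalse.IH[OF this IfFalse.prems(2)] obtain \<tau>'
    where \<tau>': "exec c2 \<tau> t \<tau>'" "\<forall>a \<in> A. \<sigma>' a = \<tau>' a" by blast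
  from exec.IfFalse[OF ev IfFalse.hyps(3) \<tau>'(1)] \<tau>'(2) show ?case by blast
next
  case (WhileFalse e1 \<sigma> v e2 w c)
  have ev: "eval e1 \<tau> = Some v" "eval e2 \<tau> = Some w"
    using eval_agree[OF WhileFalse.hyps(1) _ WhileFalse.prems(2)]
      eval_agree[OF WhileFalse.hyps(2) _ WhileFalse.prems(2)] WhileFalse.prems(1) by simp_all
  from exec.WhileFalse[OF ev WhileFalse.hyps(3)] WhileFalse.prems(2) show ?case by blast
next
  case (WhileTrue e1 \<sigma>1 v e2 w c t1 \<sigma>2 t2 \<sigma>3)
  have ev: "eval e1 \<tau> = Some v" "eval e2 \<tau> = Some w"
    using eval_agree[OF WhileTrue.hyps(1) _ WhileTrue.prems(2)]
      eval_agree[OF WhileTrue.hyps(2) _ WhileTrue.prems(2)] WhileTrue.prems(1) by simp_all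
  have sub: "com_names c \<subseteq> A" using WhileTrue.prems(1) by simp
  from WhileTrue.IH(1)[OF sub WhileTrue.prems(2)] obtain \<tau>2
    where 1: "exec c \<tau> t1 \<tau>2" "\<forall>a \<in> A. \<sigma>2 a = \<tau>2 a" by blast
  from WhileTrue.IH(2)[OF WhileTrue.prems(1) 1(2)] obtain \<tau>3
    where 2: "exec (WhileLess e1 e2 c) \<tau>2 t2 \<tau>3" "\<forall>a \<in> A. \<sigma>3 a = \<tau>3 a" by blast
  from exec.WhileTrue[OF ev WhileTrue.hyps(3) 1(1) 2(1)] 2(2) show ?case by blast
qed

section \<open>Executions with an upper bound on the time\<close>

definition runs :: "nat \<Rightarrow> com \<Rightarrow> store \<Rightarrow> store \<Rightarrow> bool" where
  "runs T c \<sigma> \<sigma>' \<longleftrightarrow> (\<exists>t\<le>T. exec c \<sigma> t \<sigma>')"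

lemma runs_exec: "exec c \<sigma> t \<sigma>' \<Longrightarrow> runs t c \<sigma> \<sigma>'"
  unfolding runs_def by blast

lemma runs_mono: "runs T c \<sigma> \<sigma>' \<Longrightarrow> T \<le> T' \<Longrightarrow> runs T' c \<sigma> \<sigma>'"
  unfolding runs_def by (meson order_trans)

lemma runs_frame: "runs T c \<sigma> \<sigma>' \<Longrightarrow> a \<notin> written_names c \<Longrightarrow> \<sigma>' a = \<sigma> a"
  unfolding runs_def using exec_frame by blast

lemma runs_Seq: "runs T1 c1 \<sigma>1 \<sigma>2 \<Longrightarrow> runs T2 c2 \<sigma>2 \<sigma>3 \<Longrightarrow> runs (T1 + T2) (Seq c1 c2) \<sigma>1 \<sigma>3"
  unfolding runs_def by (meson add_mono exec.Seq)

text \<open>On loop-free commands this agrees with \<^const>\<open>exec\<close>, so that they can be executed by rewriting.\<close>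

fun sem :: "com \<Rightarrow> store \<Rightarrow> store option" where
  "sem Skip \<sigma> = Some \<sigma>"
| "sem (Assign a i e) \<sigma> =
     (case (eval i \<sigma>, eval e \<sigma>) of
        (Some k, Some v) \<Rightarrow> if k \<in> \<nat> then Some (\<sigma>(a := (\<sigma> a)(nat \<lfloor>k\<rfloor> := v))) else None
      | _ \<Rightarrow> None)"
| "sem (New a) \<sigma> = Some (\<sigma>(a := (\<lambda>_. 0)))"
| "sem (Seq c1 c2) \<sigma> = (case sem c1 \<sigma> of Some \<sigma>' \<Rightarrow> sem c2 \<sigma>' | None \<Rightarrow> None)"
| "sem (IfLess e1 e2 c1 c2) \<sigma> =
     (case (eval e1 \<sigma>, eval e2 \<sigma>) of
        (Some v, Some w) \<Rightarrow> if v < w then sem c1 \<sigma> else sem c2 \<sigma>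
      | _ \<Rightarrow> None)"
| "sem (WhileLess e1 e2 c) \<sigma> = None"

text \<open>A conditional is charged for its dearer branch, so the bound for a loop body depends on
  the program text alone and not on the memory.\<close>

fun max_cost :: "com \<Rightarrow> nat" where
  "max_cost Skip = 1"
| "max_cost (Assign a i e) = 1 + cost i + cost e"
| "max_cost (New a) = 1"
| "max_cost (Seq c1 c2) = max_cost c1 + max_cost c2"
| "max_cost (IfLess e1 e2 c1 c2) = 1 + cost e1 + cost e2 + max (max_cost c1) (max_cost c2)"
| "max_cost (WhileLess e1 e2 c) = 1"

lemma runs_straight: "sem c \<sigma> = Some \<sigma>' \<Longrightarrow> runs (max_cost c) c \<sigma> \<sigma>'"
proof (induction c arbitrary: \<sigma> \<sigma>')
  case Skip
  then show ?case using runs_exec[OF exec.Skip] by simp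
next
  case (Assign a i e)
  then obtain k v where kv: "eval i \<sigma> = Some (of_nat k)" "eval e \<sigma> = Some v"
    "\<sigma>' = \<sigma>(a := (\<sigma> a)(k := v))"
    by (auto split: option.splits if_splits elim!: Nats_cases)
  from runs_exec[OF exec.Assign[OF kv(1,2), of a]] show ?case unfolding kv(3) max_cost.simps .
next
  case (New a)
  then show ?case using runs_exec[OF exec.New, of a \<sigma>] by simp
next
  case (Seq c1 c2)
  from Seq.prems obtain \<sigma>2 where "sem c1 \<sigma> = Some \<sigma>2" "sem c2 \<sigma>2 = Some \<sigma>'"
    by (auto split: option.splits)
  from runs_Seq[OF Seq.IH(1)[OF this(1)] Seq.IH(2)[OF this(2)]] show ?case by simp
next
  case (IfLess e1 e2 c1 c2)
  then obtain v w where vw: "eval e1 \<sigma> = Some v" "eval e2 \<sigma> = Some w"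
    "(if v < w then sem c1 \<sigma> else sem c2 \<sigma>) = Some \<sigma>'"
    by (auto split: option.splits)
  show ?case
  proof (cases "v < w")
    case True
    with vw IfLess.IH(1) obtain t where "t \<le> max_cost c1" "exec c1 \<sigma> t \<sigma>'" by (auto simp: runs_def)
    with exec.IfTrue[OF vw(1,2) True, of c1 t \<sigma>' c2] show ?thesis
      unfolding runs_def by (intro exI[of _ "1 + cost e1 + cost e2 + t"]) auto
  next
    case False
    with vw IfLess.IH(2) obtain t where "t \<le> max_cost c2" "exec c2 \<sigma> t \<sigma>'" by (auto simp: runs_def)
    with exec.IfFalse[OF vw(1,2) False, of c2 t \<sigma>' c1] show ?thesis
      unfolding runs_def by (intro exI[of _ "1 + cost e1 + cost e2 + t"]) auto
  qed
qed simp

section \<open>Counted loops\<close>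

abbreviation Var :: "nat \<Rightarrow> exp" where
  "Var a \<equiv> Cell a (Num 0)"

abbreviation Set :: "nat \<Rightarrow> exp \<Rightarrow> com" where
  "Set a e \<equiv> Assign a (Num 0) e"

definition For :: "nat \<Rightarrow> nat \<Rightarrow> com \<Rightarrow> com" where
  "For i l c = Seq (Set i (Num 0)) (WhileLess (Var i) (Var l) (Seq c (Set i (Add (Var i) (Num 1)))))"

definition for_cost :: "com \<Rightarrow> nat" where
  "for_cost c = max_cost c + 15"

text \<open>The counter lives in the memory, so the invariant has to survive any change of the array
  \<open>i\<close>. In return the body may assume that the arrays it does not write still are as
  they were before the loop. Bodies are loop-free, hence every round has the same cost
  bound.\<close>

lemma runs_For:
  fixes Inv :: "nat \<Rightarrow> store \<Rightarrow> bool"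
  assumes bound: "\<sigma> l 0 = of_nat N" and l: "l \<notin> written_names c" "l \<noteq> i" and i: "i \<notin> written_names c"
    and init: "Inv 0 \<sigma>"
    and counter: "\<And>k \<tau> u. Inv k \<tau> \<Longrightarrow> Inv k (\<tau>(i := u))"
    and step: "\<And>k \<tau>. \<lbrakk>k < N; Inv k \<tau>; \<tau> i 0 = of_nat k;
      \<And>a. a \<noteq> i \<Longrightarrow> a \<notin> written_names c \<Longrightarrow> \<tau> a = \<sigma> a\<rbrakk> \<Longrightarrow> \<exists>\<tau>'. sem c \<tau> = Some \<tau>' \<and> Inv (Suc k) \<tau>'"
  shows "\<exists>\<sigma>'. runs (for_cost c * (N + 1)) (For i l c) \<sigma> \<sigma>' \<and> Inv N \<sigma>' \<and>
    (\<forall>a. a \<noteq> i \<longrightarrow> a \<notin> written_names c \<longrightarrow> \<sigma>' a = \<sigma> a)"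
proof -
  define W where "W = WhileLess (Var i) (Var l) (Seq c (Set i (Add (Var i) (Num 1))))"
  define fr where "fr \<tau> \<longleftrightarrow> (\<forall>a. a \<noteq> i \<longrightarrow> a \<notin> written_names c \<longrightarrow> \<tau> a = \<sigma> a)" for \<tau>
  \<comment> \<open>A test costs 5 and the increment of the counter 6, which makes 11 per round on
    top of the body; the last 5 pay for the failing test.\<close>
  have loop: "\<exists>\<sigma>'. runs ((max_cost c + 11) * (N - k) + 5) W \<tau> \<sigma>' \<and> Inv N \<sigma>' \<and> fr \<sigma>'"
    if "k \<le> N" "Inv k \<tau>" "\<tau> i 0 = of_nat k" "fr \<tau>" for k \<tau>
    using that
  proof (induction "N - k" arbitrary: k \<tau>)
    case 0
    then have "k = N" by simp
    have e: "eval (Var i) \<tau> = Some (of_nat N)" "eval (Var l) \<tau> = Some (of_nat N)"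
      using 0 l bound \<open>k = N\<close> by (auto simp: fr_def)
    have "exec W \<tau> 5 \<tau>" unfolding W_def
      using exec.WhileFalse[OF e] by (simp add: eval_nat_numeral)
    then have "runs ((max_cost c + 11) * (N - k) + 5) W \<tau> \<tau>"
      by (rule runs_mono[OF runs_exec]) simp
    with 0 \<open>k = N\<close> show ?case by blast
  next
    case (Suc j)
    then have kN: "k < N" by simp
    from Suc(4,5,6) kN obtain \<tau>' where \<tau>': "sem c \<tau> = Some \<tau>'" "Inv (Suc k) \<tau>'"
      using step[of k \<tau>] by (auto simp: fr_def)
    define \<tau>2 where "\<tau>2 = \<tau>'(i := (\<tau>' i)(0 := of_nat (Suc k)))"
    from runs_straight[OF \<tau>'(1)] obtain t where t: "t \<le> max_cost c" "exec c \<tau> t \<tau>'"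
      by (auto simp: runs_def)
    have \<tau>'i: "\<tau>' i 0 = of_nat k" using exec_frame[OF t(2) i] Suc by simp
    have "exec (Set i (Add (Var i) (Num 1))) \<tau>' 6 \<tau>2"
      using exec.Assign[of "Num 0" \<tau>' 0 "Add (Var i) (Num 1)" "of_nat (Suc k)" i] \<tau>'i
      by (simp add: \<tau>2_def eval_nat_numeral)
    from exec.Seq[OF t(2) this]
    have body: "exec (Seq c (Set i (Add (Var i) (Num 1)))) \<tau> (t + 6) \<tau>2" .
    have "fr \<tau>2" using exec_frame[OF t(2)] Suc(6) by (auto simp: fr_def \<tau>2_def)
    moreover have "Inv (Suc k) \<tau>2" using counter \<tau>'(2) by (auto simp: \<tau>2_def)
    ultimately obtain \<sigma>' where \<sigma>': "runs ((max_cost c + 11) * (N - Suc k) + 5) W \<tau>2 \<sigma>'" "Inv N \<sigma>'" "fr \<sigma>'"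
      using Suc(1)[of "Suc k" \<tau>2] Suc(2) kN by (fastforce simp: \<tau>2_def)
    then obtain t2 where t2: "t2 \<le> (max_cost c + 11) * (N - Suc k) + 5" "exec W \<tau>2 t2 \<sigma>'"
      by (auto simp: runs_def)
    have e: "eval (Var i) \<tau> = Some (of_nat k)" "eval (Var l) \<tau> = Some (of_nat N)" "of_nat k < (of_nat N :: rat)"
      using Suc(5,6) l bound kN by (auto simp: fr_def)
    have "exec W \<tau> (5 + (t + 6) + t2) \<sigma>'"
      using exec.WhileTrue[OF e body t2(2)[unfolded W_def]] by (simp add: W_def)
    moreover have "5 + (t + 6) + t2 \<le> (max_cost c + 11) * (N - k) + 5"
    proof -
      have "N - k = Suc (N - Suc k)" using kN by simp
      then show ?thesis using t t2 by simp
    qed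
    ultimately have "runs ((max_cost c + 11) * (N - k) + 5) W \<tau> \<sigma>'" unfolding runs_def by blast
    with \<sigma>' show ?case by blast
  qed
  define \<sigma>1 where "\<sigma>1 = \<sigma>(i := (\<sigma> i)(0 := 0))"
  have "exec (Set i (Num 0)) \<sigma> 3 \<sigma>1"
    using exec.Assign[of "Num 0" \<sigma> 0 "Num 0" 0 i] by (simp add: \<sigma>1_def eval_nat_numeral)
  then have r1: "runs 3 (Set i (Num 0)) \<sigma> \<sigma>1" by (rule runs_exec)
  have "Inv 0 \<sigma>1" "fr \<sigma>1" "\<sigma>1 i 0 = of_nat 0" using counter init by (auto simp: \<sigma>1_def fr_def)
  from loop[OF _ this(1,3,2)] obtain \<sigma>' where "runs ((max_cost c + 11) * N + 5) W \<sigma>1 \<sigma>'" "Inv N \<sigma>'" "fr \<sigma>'"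
    by auto
  with runs_Seq[OF r1 this(1)]
  have "runs (3 + ((max_cost c + 11) * N + 5)) (For i l c) \<sigma> \<sigma>'" by (simp add: For_def W_def)
  then have "runs (for_cost c * (N + 1)) (For i l c) \<sigma> \<sigma>'"
    by (rule runs_mono) (simp add: for_cost_def algebra_simps)
  with \<open>Inv N \<sigma>'\<close> \<open>fr \<sigma>'\<close> show ?thesis unfolding fr_def by blast
qed

text \<open>\<open>New\<close> costs one unit whatever the array contained, so wiping the memory of
  the subroutine takes a time that depends on the bound for its names only.\<close>

fun clear_below :: "nat \<Rightarrow> com" where
  "clear_below 0 = Skip"
| "clear_below (Suc k) = Seq (clear_below k) (New k)"

lemma sem_clear_below: "sem (clear_below K) \<sigma> = Some (\<lambda>a. if a < K then (\<lambda>_. 0) else \<sigma> a)"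
  by (induction K) (auto simp: fun_eq_iff)

section \<open>Logarithmic estimates for the primal and the dual step\<close>

section \<open>Steps that decrease the potential\<close>

definition pot :: "nat \<Rightarrow> nat \<Rightarrow> (nat \<Rightarrow> real) \<Rightarrow> (nat \<Rightarrow> real) \<Rightarrow> real" where
  "pot q m x s = real q * ln (\<Sum>a<m. x a * s a) - (\<Sum>a<m. ln (x a * s a)) - real m * ln (real m)"

text \<open>The inequality of the means in logarithmic form: ln w \<le> w - 1 is applied to each
  term divided by the mean, and the linear parts cancel in the sum.\<close>

lemma sum_ln_le:
  fixes z :: "nat \<Rightarrow> real"
  assumes "m \<ge> 1" and pos: "\<And>a. a < m \<Longrightarrow> z a > 0"
  shows "(\<Sum>a<m. ln (z a)) \<le> real m * ln (\<Sum>a<m. z a) - real m * ln (real m)"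
proof -
  define S where "S = (\<Sum>a<m. z a)"
  have S: "S > 0" unfolding S_def using assms by (intro sum_pos) (auto simp: lessThan_empty_iff)
  have "ln (z a) \<le> (ln S - ln (real m)) + (real m / S * z a - 1)" if "a < m" for a
  proof -
    have "ln (real m / S * z a) \<le> real m / S * z a - 1"
      using that pos S assms by (intro ln_le_minus_one) auto
    then show ?thesis using that pos[OF that] S assms by (simp add: ln_mult ln_div)
  qed
  then have "(\<Sum>a<m. ln (z a)) \<le> (\<Sum>a<m. (ln S - ln (real m)) + (real m / S * z a - 1))"
    by (intro sum_mono) auto
  also have "\<dots> = real m * (ln S - ln (real m)) + (real m / S * S - real m)"
    unfolding S_def by (simp add: sum.distrib sum_subtractf sum_distrib_left)
  also have "\<dots> = real m * ln S - real m * ln (real m)" using S by (simp add: algebra_simps)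
  finally show ?thesis unfolding S_def .
qed

text \<open>Used twice: a gap of at least 1 forces a nonnegative potential, which ends the loop, and
  the bound is the value with which the dual step compares its new potential.\<close>

lemma pot_ge:
  assumes "m \<ge> 1" "\<And>a. a < m \<Longrightarrow> x a > 0" "\<And>a. a < m \<Longrightarrow> s a > 0"
  shows "pot (m + k) m x s \<ge> real k * ln (\<Sum>a<m. x a * s a)"
  using sum_ln_le[of m "\<lambda>a. x a * s a"] assms by (simp add: pot_def algebra_simps)

lemma ln_one_plus_lower:
  fixes d :: real
  assumes "\<bar>d\<bar> \<le> 1/2"
  shows "d - 2 * d\<^sup>2 \<le> ln (1 + d)"
  using abs_ln_one_plus_x_minus_x_bound[OF assms] by simp

text \<open>The new gap is D (1 - \<alpha> E), whose logarithm is at most ln D - \<alpha> E, and the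
  barrier terms are expanded to second order. Together the potential falls by at least \<alpha>
  times the left side of \<open>desc\<close>, minus 2 \<alpha>^2 N.\<close>

lemma primal_step_decreases_pot:
  fixes x s d :: "nat \<Rightarrow> real"
  assumes m: "m \<ge> 1" and q: "q > 0"
    and x: "\<And>a. a < m \<Longrightarrow> x a > 0" and s: "\<And>a. a < m \<Longrightarrow> s a > 0"
    and D: "D = (\<Sum>a<m. x a * s a)" and N: "N = (\<Sum>a<m. (d a)\<^sup>2)"
    and desc: "(\<Sum>a<m. (real q * (x a * s a) / D - 1) * d a) \<ge> N / 2 + 1 / 128"
    and \<alpha>: "\<alpha> = 1 / (128 * (N + 1))" and x': "\<And>a. a < m \<Longrightarrow> x' a = x a * (1 - \<alpha> * d a)"
  shows "\<And>a. a < m \<Longrightarrow> x' a > 0" and "pot q m x' s \<le> pot q m x s - 1 / 32768"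
proof -
  have N0: "N \<ge> 0" unfolding N by (intro sum_nonneg) auto
  have \<alpha>0: "\<alpha> > 0" using N0 by (simp add: \<alpha>)
  have small: "\<bar>\<alpha> * d a\<bar> \<le> 1/2" if "a < m" for a
  proof -
    have "(d a)\<^sup>2 \<le> N" unfolding N using that by (intro member_le_sum) auto
    \<comment> \<open>This takes the place of the bound by the square root of N: it lets the
      rational quantity N + 1 control every coordinate.\<close>
    moreover have "2 * \<bar>d a\<bar> \<le> (d a)\<^sup>2 + 1" using zero_le_power2[of "\<bar>d a\<bar> - 1"]
      by (simp add: power2_eq_square algebra_simps)
    ultimately have "\<bar>d a\<bar> \<le> (N + 1) / 2" by simp
    then have "\<alpha> * \<bar>d a\<bar> \<le> \<alpha> * ((N + 1) / 2)" using \<alpha>0 by (intro mult_left_mono) auto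
    also have "\<dots> \<le> 1/2" using N0 by (simp add: \<alpha> field_simps)
    finally show ?thesis using \<alpha>0 by (simp add: abs_mult)
  qed
  have pos1: "1 - \<alpha> * d a > 0" if "a < m" for a using small[OF that] by linarith
  show x'0: "x' a > 0" if "a < m" for a using that x' x pos1 by simp
  have D0: "D > 0" unfolding D using m x s by (intro sum_pos) (auto simp: lessThan_empty_iff)
  define E where "E = (\<Sum>a<m. x a * s a * d a) / D"
  have D': "(\<Sum>a<m. x' a * s a) = D * (1 - \<alpha> * E)"
  proof -
    have "(\<Sum>a<m. x' a * s a) = (\<Sum>a<m. x a * s a - \<alpha> * (x a * s a * d a))"
      by (intro sum.cong refl) (simp add: x' right_diff_distrib left_diff_distrib mult.assoc mult.left_commute mult.commute)
    also have "\<dots> = D - \<alpha> * (\<Sum>a<m. x a * s a * d a)" by (simp add: D sum_subtractf sum_distrib_left)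
    also have "(\<Sum>a<m. x a * s a * d a) = D * E" using D0 by (simp add: E_def)
    finally show ?thesis by (simp add: algebra_simps)
  qed
  have "(\<Sum>a<m. x' a * s a) > 0"
    using m x'0 s by (intro sum_pos) (auto simp: lessThan_empty_iff)
  then have E1: "1 - \<alpha> * E > 0" using D' D0 by (simp add: zero_less_mult_iff)
  have "ln (1 - \<alpha> * E) \<le> - (\<alpha> * E)" using ln_le_minus_one[OF E1] by simp
  then have "real q * ln (1 - \<alpha> * E) \<le> real q * (- (\<alpha> * E))" by (intro mult_left_mono) auto
  then have l1: "real q * ln (\<Sum>a<m. x' a * s a) \<le> real q * ln D - \<alpha> * (real q * E)"
    unfolding D' ln_mult_pos[OF D0 E1] by (simp add: algebra_simps)
  have "(\<Sum>a<m. ln (x' a * s a)) = (\<Sum>a<m. ln (x a * s a) + ln (1 + (- (\<alpha> * d a))))"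
  proof (intro sum.cong refl)
    fix a assume "a \<in> {..<m}"
    then have "x' a * s a = (x a * s a) * (1 + (- (\<alpha> * d a)))" "x a * s a > 0" "1 + (- (\<alpha> * d a)) > 0"
      using x' x s pos1 by auto
    then show "ln (x' a * s a) = ln (x a * s a) + ln (1 + (- (\<alpha> * d a)))"
      by (metis ln_mult_pos)
  qed
  moreover have "(\<Sum>a<m. ln (x a * s a) + ln (1 + (- (\<alpha> * d a)))) \<ge>
      (\<Sum>a<m. ln (x a * s a) + (- (\<alpha> * d a) - 2 * (- (\<alpha> * d a))\<^sup>2))"
    using small by (intro sum_mono add_left_mono ln_one_plus_lower) auto
  moreover have "(\<Sum>a<m. ln (x a * s a) + (- (\<alpha> * d a) - 2 * (- (\<alpha> * d a))\<^sup>2)) =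
      (\<Sum>a<m. ln (x a * s a)) - \<alpha> * (\<Sum>a<m. d a) - 2 * \<alpha>\<^sup>2 * N"
    unfolding N by (simp add: sum.distrib sum_subtractf sum_negf sum_distrib_left power_mult_distrib mult.assoc)
  ultimately have l2: "(\<Sum>a<m. ln (x' a * s a)) \<ge>
      (\<Sum>a<m. ln (x a * s a)) - \<alpha> * (\<Sum>a<m. d a) - 2 * \<alpha>\<^sup>2 * N" by simp
  have qE: "real q * E = (\<Sum>a<m. (real q * (x a * s a) / D - 1) * d a) + (\<Sum>a<m. d a)"
    by (simp add: E_def sum.distrib[symmetric] sum_divide_distrib sum_distrib_left algebra_simps)
  have "\<alpha> * (real q * E) - \<alpha> * (\<Sum>a<m. d a) - 2 * \<alpha>\<^sup>2 * N \<ge> 1 / 32768"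
  proof -
    have "\<alpha> * (N / 2 + 1 / 128) \<le> \<alpha> * (real q * E - (\<Sum>a<m. d a))"
      using \<alpha>0 desc qE by (intro mult_left_mono) auto
    moreover have "\<alpha> * (N / 2 + 1 / 128) \<ge> \<alpha> * ((N + 1) / 128)"
      using \<alpha>0 N0 by (intro mult_left_mono) auto
    \<comment> \<open>The step length turns the linear gain into this constant. The quadratic loss
      is at most half of it because 4 N \<le> (N + 1)^2, and 1 / 32768 remains.\<close>
    moreover have "\<alpha> * ((N + 1) / 128) = 1 / 16384" using N0 by (simp add: \<alpha> field_simps)
    moreover have "2 * \<alpha>\<^sup>2 * N \<le> 1 / 32768"
    proof -
      define M where "M = N + 1"
      have "4 * N \<le> M\<^sup>2" using zero_le_power2[of "N - 1"] by (simp add: M_def power2_eq_square algebra_simps)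
      moreover have "2 * \<alpha>\<^sup>2 * N = N / (8192 * M\<^sup>2)"
        unfolding \<alpha> M_def[symmetric] by (simp add: power_divide power_mult_distrib)
      moreover have "M\<^sup>2 > 0" using N0 by (simp add: M_def)
      ultimately show ?thesis by (simp only:) (simp add: divide_simps)
    qed
    ultimately show ?thesis by (simp add: right_diff_distrib)
  qed
  with l1 l2 show "pot q m x' s \<le> pot q m x s - 1 / 32768"
    unfolding pot_def D[symmetric] by linarith
qed

text \<open>After the step the products x a * s' a equal D / q * (1 + d a), so the point is nearly
  central and its gap is D (m + T) / q. The comparison is with the lower bound k ln D of the old
  potential: near centrality costs little over that bound, while the smaller gap gains a
  constant.\<close>

lemma dual_step_decreases_pot:
  fixes x s s' v :: "nat \<Rightarrow> real"
  assumes m: "m \<ge> 1" and k: "m \<le> k\<^sup>2" and q: "q = m + k"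
    and x: "\<And>a. a < m \<Longrightarrow> x a > 0" and s: "\<And>a. a < m \<Longrightarrow> s a > 0"
    and D: "D = (\<Sum>a<m. x a * s a)"
    and small: "(\<Sum>a<m. (real q * (x a * s a) / D - 1 - x a * v a)\<^sup>2) \<le> 9 / 64"
    and s': "\<And>a. a < m \<Longrightarrow> s' a = s a - D / real q * v a"
  shows "\<And>a. a < m \<Longrightarrow> s' a > 0" and "pot q m x s' \<le> pot q m x s - 1 / 32"
proof -
  define d where "d a = real q * (x a * s a) / D - 1 - x a * v a" for a
  have k1: "k \<ge> 1" using m k by (cases k) auto
  have q0: "real q > 0" using q m by simp
  have D0: "D > 0" unfolding D using m x s by (intro sum_pos) (auto simp: lessThan_empty_iff)
  \<comment> \<open>As the square of 3/8, the threshold keeps the new slacks positive and stays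
    inside the range of the logarithm bound.\<close>
  have d38: "\<bar>d a\<bar> \<le> 3/8" if "a < m" for a
  proof -
    have "(d a)\<^sup>2 \<le> 9/64" using that small member_le_sum[of a "{..<m}" "\<lambda>a. (d a)\<^sup>2"]
      unfolding d_def by fastforce
    then have "\<bar>d a\<bar>\<^sup>2 \<le> (3/8)\<^sup>2" by (simp add: power2_eq_square)
    then show ?thesis by (rule power2_le_imp_le) simp
  qed
  have xs': "x a * s' a = D / real q * (1 + d a)" if "a < m" for a
  proof -
    have "D / real q * (1 + d a) = x a * s a - D / real q * (x a * v a)"
      using q0 D0 by (simp add: d_def field_simps)
    also have "\<dots> = x a * (s a - D / real q * v a)" by (simp add: right_diff_distrib mult.left_commute)
    finally show ?thesis using s'[OF that] by simp
  qed
  show "s' a > 0" if "a < m" for a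
  proof -
    have "x a * s' a > 0" unfolding xs'[OF that] using d38[OF that] q0 D0 by (intro mult_pos_pos) auto
    then show ?thesis using x[OF that] by (simp add: zero_less_mult_iff)
  qed
  define T where "T = (\<Sum>a<m. d a)"
  have mT: "real m + T = (\<Sum>a<m. 1 + d a)" by (simp add: T_def sum.distrib)
  have mT0: "real m + T > 0" unfolding mT using m d38 by (intro sum_pos) (force simp: lessThan_empty_iff)+
  \<comment> \<open>Cauchy-Schwarz against the constant vector, read off from the nonnegative
    variance of d. With m \<le> k^2 it gives T \<le> 3/8 k, so the gap really shrinks.\<close>
  have "T\<^sup>2 \<le> real m * (\<Sum>a<m. (d a)\<^sup>2)"
  proof -
    have "0 \<le> (\<Sum>a<m. (d a - T / real m)\<^sup>2)" by (intro sum_nonneg) auto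
    also have "\<dots> = (\<Sum>a<m. (d a)\<^sup>2 - 2 * (T / real m) * d a + (T / real m)\<^sup>2)"
      by (intro sum.cong) (simp_all add: power2_eq_square algebra_simps)
    also have "\<dots> = (\<Sum>a<m. (d a)\<^sup>2) - 2 * (T / real m) * T + real m * (T / real m)\<^sup>2"
      by (simp add: T_def sum.distrib sum_subtractf sum_distrib_left)
    finally show ?thesis using m by (simp add: power2_eq_square field_simps)
  qed
  also have "\<dots> \<le> (real k)\<^sup>2 * (9/64)"
    using small k by (intro mult_mono sum_nonneg) (auto simp: d_def simp flip: of_nat_power)
  also have "\<dots> = (3/8 * real k)\<^sup>2" by (simp add: power2_eq_square)
  finally have Tk: "T \<le> 3/8 * real k" by (rule power2_le_imp_le) simp
  have "(\<Sum>a<m. ln (1 + d a)) \<ge> (\<Sum>a<m. d a - 2 * (d a)\<^sup>2)"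
    using d38 by (intro sum_mono ln_one_plus_lower) force
  then have l1: "(\<Sum>a<m. ln (1 + d a)) \<ge> T - 9/32"
    using small by (simp add: d_def[symmetric] T_def sum_subtractf sum_distrib_left[symmetric])
  have l2: "real m * (ln (real m + T) - ln (real m)) \<le> T"
  proof -
    have "ln ((real m + T) / real m) \<le> (real m + T) / real m - 1" using mT0 m by (intro ln_le_minus_one) auto
    then have "real m * ln ((real m + T) / real m) \<le> real m * (T / real m)"
      using m by (intro mult_left_mono) (auto simp: add_divide_distrib)
    then show ?thesis using mT0 m by (simp add: ln_div)
  qed
  have l3: "real k * (ln (real m + T) - ln (real q)) \<le> - 5/16"
  proof -
    have "ln ((real m + T) / real q) \<le> (real m + T) / real q - 1" using mT0 q0 by (intro ln_le_minus_one) auto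
    also have "\<dots> = (T - real k) / real q" using q0 by (simp add: q field_simps)
    also have "\<dots> \<le> (- 5/8 * real k) / real q" using Tk q0 by (intro divide_right_mono) auto
    finally have "real k * ln ((real m + T) / real q) \<le> real k * ((- 5/8 * real k) / real q)"
      by (intro mult_left_mono) auto
    also have "\<dots> = - 5/8 * ((real k)\<^sup>2 / real q)" by (simp add: power2_eq_square)
    also have "\<dots> \<le> - 5/8 * (1/2)"
    proof -
      \<comment> \<open>The relative decrease of the gap is of order k / q and counts k times; it
        amounts to a constant because k^2 is at least half of q.\<close>
      have "k \<le> k\<^sup>2" by (simp add: power2_eq_square)
      with k have "q \<le> 2 * k\<^sup>2" by (simp add: q)
      then have "real q \<le> 2 * (real k)\<^sup>2" by (metis of_nat_le_iff of_nat_mult of_nat_numeral of_nat_power)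
      then have "1/2 \<le> (real k)\<^sup>2 / real q" using q0 by (simp add: field_simps)
      then show ?thesis by simp
    qed
    finally show ?thesis using mT0 q0 by (simp add: ln_div)
  qed
  have "(\<Sum>a<m. x a * s' a) = D / real q * (real m + T)"
    unfolding mT using xs' by (simp add: sum_distrib_left)
  then have e1: "ln (\<Sum>a<m. x a * s' a) = ln D - ln (real q) + ln (real m + T)"
    using D0 q0 mT0 by (simp add: ln_mult ln_div)
  have "(\<Sum>a<m. ln (x a * s' a)) = (\<Sum>a<m. (ln D - ln (real q)) + ln (1 + d a))"
  proof (intro sum.cong refl)
    fix a assume "a \<in> {..<m}"
    then have "x a * s' a = D / real q * (1 + d a)" "1 + d a > 0" using xs' d38[of a] by auto
    then show "ln (x a * s' a) = (ln D - ln (real q)) + ln (1 + d a)"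
      using D0 q0 by (simp add: ln_mult ln_div)
  qed
  then have e2: "(\<Sum>a<m. ln (x a * s' a)) = real m * (ln D - ln (real q)) + (\<Sum>a<m. ln (1 + d a))"
    by (simp add: sum.distrib)
  have "pot q m x s \<ge> real k * ln D" unfolding q D using pot_ge[OF m x s] by simp
  moreover have "pot q m x s' = real k * ln D + real k * (ln (real m + T) - ln (real q))
      + real m * (ln (real m + T) - ln (real m)) - (\<Sum>a<m. ln (1 + d a))"
    unfolding pot_def e1 e2 by (simp add: q algebra_simps)
  \<comment> \<open>The deviation T cancels: - 5/16 + T - (T - 9/32) = - 1/32.\<close>
  ultimately show "pot q m x s' \<le> pot q m x s - 1 / 32" using l1 l2 l3 by linarith
qed

text \<open>The shares x a * s a / D form a probability vector, whose squared norm is at most 1;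
  expanding the square then leaves at most q^2 - 2 q + m. This bound is what the precision 1 / (16
  q^2) of the call is tuned to.\<close>

lemma gradient_norm_le:
  fixes x s :: "nat \<Rightarrow> real"
  assumes "m \<ge> 1" "m \<le> q" and x: "\<And>a. a < m \<Longrightarrow> x a > 0" and s: "\<And>a. a < m \<Longrightarrow> s a > 0"
    and D: "D = (\<Sum>a<m. x a * s a)"
  shows "(\<Sum>a<m. (real q * (x a * s a) / D - 1)\<^sup>2) \<le> (real q)\<^sup>2"
proof -
  define p where "p a = x a * s a / D" for a
  have D0: "D > 0" unfolding D using assms by (intro sum_pos) (auto simp: lessThan_empty_iff)
  have p1: "(\<Sum>a<m. p a) = 1" using D0 by (simp add: p_def D sum_divide_distrib[symmetric])
  have p0: "p a \<ge> 0" if "a < m" for a using x[OF that] s[OF that] D0 by (simp add: p_def)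
  have "(p a)\<^sup>2 \<le> p a" if "a < m" for a
  proof -
    have "p a \<le> 1" using member_le_sum[of a "{..<m}" p] that p0 p1 by simp
    then show ?thesis using p0[OF that] by (simp add: power2_eq_square mult_left_le)
  qed
  then have "(\<Sum>a<m. (p a)\<^sup>2) \<le> 1" unfolding p1[symmetric] by (intro sum_mono) auto
  then have "(real q)\<^sup>2 * (\<Sum>a<m. (p a)\<^sup>2) \<le> (real q)\<^sup>2" by (intro mult_left_le) auto
  moreover have "(\<Sum>a<m. (real q * (x a * s a) / D - 1)\<^sup>2)
      = (\<Sum>a<m. (real q)\<^sup>2 * (p a)\<^sup>2 - 2 * real q * p a + 1)"
    by (intro sum.cong) (simp_all add: p_def power2_diff power_mult_distrib power_divide)
  moreover have "\<dots> = (real q)\<^sup>2 * (\<Sum>a<m. (p a)\<^sup>2) - 2 * real q * (\<Sum>a<m. p a) + real m"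
    by (simp add: sum.distrib sum_subtractf sum_distrib_left)
  ultimately show ?thesis using p1 assms(2) by simp
qed

text \<open>Expanding the squares turns the claim into |g|^2 - |u|^2 \<ge> 1/64. By Pythagoras |g|^2
  = |po|^2 + |g - po|^2, and g - po is orthogonal to p - po, so |g - po|^2 = |g - p|^2 - |p - po|^2
  > 9/64 - 4/64. Another 4/64 is lost in passing from |po|^2 to |u|^2. This is the origin of the
  threshold 9/64 and of the constant 1/128.\<close>

lemma descent_of_projections:
  fixes g u p po :: "nat \<Rightarrow> real"
  assumes o1: "(\<Sum>a<m. (g a - u a) * po a) = 0" and o2: "(\<Sum>a<m. (g a - po a) * po a) = 0"
    and o3: "(\<Sum>a<m. (g a - po a) * p a) = 0"
    and p: "(\<Sum>a<m. (p a - po a)\<^sup>2) \<le> 1/16"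
    and u: "(\<Sum>a<m. (u a)\<^sup>2) \<le> (\<Sum>a<m. (po a)\<^sup>2) + 1/16"
    and large: "(\<Sum>a<m. (g a - p a)\<^sup>2) > 9/64"
  shows "(\<Sum>a<m. g a * (g a - u a)) \<ge> (\<Sum>a<m. (g a - u a)\<^sup>2) / 2 + 1 / 128"
proof -
  have sq: "(\<Sum>a<m. (v a - w a)\<^sup>2) = (\<Sum>a<m. v a * v a) - 2 * (\<Sum>a<m. v a * w a) + (\<Sum>a<m. w a * w a)"
    for v w :: "nat \<Rightarrow> real"
    by (simp add: power2_eq_square algebra_simps sum.distrib sum_subtractf sum_distrib_left)
  have dist: "(\<Sum>a<m. (v a - w a) * z a) = (\<Sum>a<m. v a * z a) - (\<Sum>a<m. w a * z a)"
    "(\<Sum>a<m. z a * (v a - w a)) = (\<Sum>a<m. z a * v a) - (\<Sum>a<m. z a * w a)"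
    for v w z :: "nat \<Rightarrow> real"
    by (simp_all add: algebra_simps sum_subtractf)
  have "(\<Sum>a<m. po a * p a) = (\<Sum>a<m. p a * po a)" by (simp add: mult.commute)
  with assms show ?thesis unfolding sq dist unfolding power2_eq_square by argo
qed

section \<open>Energies, optimal voltages and the descent direction of an electrical flow\<close>

lemma sq_norm_wrt_resistance_mat:
  assumes "r \<in> carrier_vec m" "f \<in> carrier_vec m"
  shows "sq_norm_wrt (resistance_mat r) f = (\<Sum>a<m. r $ a * (f $ a)\<^sup>2)"
proof -
  have "(resistance_mat r *\<^sub>v f) $ a = r $ a * f $ a" if "a < m" for a
    using assms that by (simp add: resistance_mat_def mat_diag_def scalar_prod_def if_distrib[of "\<lambda>z. z * _"] cong: if_cong)
  then show ?thesis using assms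
    by (auto simp: sq_norm_wrt_def scalar_prod_def resistance_mat_def mat_diag_def power2_eq_square
        atLeast0LessThan intro!: sum.cong)
qed

lemma scalar_prod_weighted_laplacian:
  fixes A :: "real mat"
  assumes A: "A \<in> carrier_mat n m" and r: "r \<in> carrier_vec m" and v: "v \<in> carrier_vec n" and w: "w \<in> carrier_vec n"
  shows "v \<bullet> (weighted_laplacian A r *\<^sub>v w) =
    (\<Sum>a<m. inverse (r $ a) * ((A\<^sup>T *\<^sub>v v) $ a * (A\<^sup>T *\<^sub>v w) $ a))"
proof -
  define C where "C = conductance_mat r"
  have C: "C \<in> carrier_mat m m" using r by (simp add: C_def conductance_mat_def mat_diag_def)
  define z where "z = A\<^sup>T *\<^sub>v w"
  have z: "z \<in> carrier_vec m" unfolding z_def using A w by (intro mult_mat_vec_carrier) auto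
  have "weighted_laplacian A r *\<^sub>v w = A *\<^sub>v (C *\<^sub>v z)"
    unfolding weighted_laplacian_def C_def[symmetric] z_def
    using A C w assoc_mult_mat_vec[of "A * C" n m "A\<^sup>T" n w] assoc_mult_mat_vec[OF A C, of "A\<^sup>T *\<^sub>v w"]
      mult_mat_vec_carrier[of "A\<^sup>T" m n w] by simp
  then have "v \<bullet> (weighted_laplacian A r *\<^sub>v w) = (A\<^sup>T *\<^sub>v v) \<bullet> (C *\<^sub>v z)"
    using transpose_vec_mult_scalar[OF A _ v, of "C *\<^sub>v z"] C z by simp
  moreover have "(C *\<^sub>v z) $ a = inverse (r $ a) * z $ a" if "a < m" for a
    using r z that
    by (simp add: C_def conductance_mat_def mat_diag_def scalar_prod_def if_distrib[of "\<lambda>z. z * _"] cong: if_cong)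
  ultimately show ?thesis using C z A
    by (auto simp: scalar_prod_def z_def[symmetric] atLeast0LessThan intro!: sum.cong)
qed

lemma quadratic_bound_imp_zero:
  fixes b c :: real
  assumes "b \<ge> 0" "\<And>t. 2 * t * c - t\<^sup>2 * b \<le> 0"
  shows "c = 0"
proof (rule ccontr)
  assume "c \<noteq> 0"
  \<comment> \<open>The maximiser would be c / b; dividing by b + 1 covers b = 0 as well and still
    gives a positive value.\<close>
  have "2 * (c / (b + 1)) * c - (c / (b + 1))\<^sup>2 * b = c\<^sup>2 * (b + 2) / (b + 1)\<^sup>2"
    using assms(1) by (simp add: divide_simps power2_eq_square) (simp add: algebra_simps)
  moreover have "\<dots> > 0" using assms(1) \<open>c \<noteq> 0\<close> by (intro divide_pos_pos mult_pos_pos) auto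
  ultimately show False using assms(2)[of "c / (b + 1)"] by simp
qed

text \<open>First-order optimality of the dual objective along the line through the optimum in
  direction \<rho>. No inverse of the Laplacian occurs, which is singular, and no uniqueness of the
  voltages.\<close>

lemma optimal_voltages_normal_equation:
  assumes A: "A \<in> carrier_mat n m" and r: "r \<in> carrier_vec m" "\<And>a. a < m \<Longrightarrow> r $ a > 0"
    and \<chi>: "\<chi> \<in> carrier_vec n" and opt: "optimal_voltages A r \<chi> \<pi>" and \<rho>: "\<rho> \<in> carrier_vec n"
  shows "\<rho> \<bullet> \<chi> = (\<Sum>a<m. inverse (r $ a) * ((A\<^sup>T *\<^sub>v \<rho>) $ a * (A\<^sup>T *\<^sub>v \<pi>) $ a))"
proof -
  have \<pi>: "\<pi> \<in> carrier_vec n" using opt A by (simp add: optimal_voltages_def)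
  define u where "u a = (A\<^sup>T *\<^sub>v \<rho>) $ a" for a
  define w where "w a = (A\<^sup>T *\<^sub>v \<pi>) $ a" for a
  define B where "B f g = (\<Sum>a<m. inverse (r $ a) * (f a * g a))" for f g :: "nat \<Rightarrow> real"
  have AT: "A\<^sup>T \<in> carrier_mat m n" using A by simp
  have "2 * t * (\<rho> \<bullet> \<chi> - B u w) - t\<^sup>2 * B u u \<le> 0" for t
  proof -
    define \<tau> where "\<tau> = \<pi> + t \<cdot>\<^sub>v \<rho>"
    have \<tau>: "\<tau> \<in> carrier_vec n" using \<pi> \<rho> by (simp add: \<tau>_def)
    have co: "(A\<^sup>T *\<^sub>v \<tau>) $ a = w a + t * u a" if "a < m" for a
      using that A \<pi> \<rho> mult_add_distrib_mat_vec[OF AT \<pi>, of "t \<cdot>\<^sub>v \<rho>"] mult_mat_vec[OF AT \<rho>, of t]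
      by (simp add: \<tau>_def u_def w_def)
    have "\<tau> \<bullet> (weighted_laplacian A r *\<^sub>v \<tau>) = (\<Sum>a<m. inverse (r $ a) * ((w a + t * u a) * (w a + t * u a)))"
      unfolding scalar_prod_weighted_laplacian[OF A r(1) \<tau> \<tau>] by (intro sum.cong) (auto simp: co)
    also have "\<dots> = B w w + 2 * t * B u w + t\<^sup>2 * B u u"
      by (simp add: B_def sum_distrib_left sum.distrib[symmetric] power2_eq_square algebra_simps)
    finally have 1: "\<tau> \<bullet> (weighted_laplacian A r *\<^sub>v \<tau>) = B w w + 2 * t * B u w + t\<^sup>2 * B u u" .
    have 2: "\<pi> \<bullet> (weighted_laplacian A r *\<^sub>v \<pi>) = B w w"
      unfolding scalar_prod_weighted_laplacian[OF A r(1) \<pi> \<pi>] by (simp add: B_def w_def)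
    have 3: "\<tau> \<bullet> \<chi> = \<pi> \<bullet> \<chi> + t * (\<rho> \<bullet> \<chi>)"
      using \<pi> \<rho> \<chi> by (simp add: \<tau>_def add_scalar_prod_distrib[of _ n])
    have "dual_objective A r \<chi> \<tau> \<le> dual_objective A r \<chi> \<pi>"
      using opt \<tau> A by (simp add: optimal_voltages_def)
    then show ?thesis unfolding dual_objective_def 1 2 3 by (simp add: algebra_simps)
  qed
  moreover have "B u u \<ge> 0" unfolding B_def
    by (intro sum_nonneg mult_nonneg_nonneg[OF _ zero_le_square]) (auto intro!: less_imp_le[OF r(2)])
  ultimately have "\<rho> \<bullet> \<chi> - B u w = 0" by (rule quadratic_bound_imp_zero[rotated])
  then show ?thesis by (simp add: B_def u_def w_def)
qed

text \<open>For resistances 1 / x^2, dividing a flow by x and multiplying potential differences by x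
  turn both energies into Euclidean norms. The vectors g, u and po have the same product with x a
  times the a-th entry of A^T \<rho>, summed over the arcs, namely \<rho> \<bullet> \<chi>; taking
  for \<rho> the optimal and the computed voltages yields all orthogonality relations.\<close>

lemma electrical_step_descent:
  fixes A :: "real mat" and x g :: "nat \<Rightarrow> real"
  assumes A: "A \<in> carrier_mat n m" and x: "\<And>a. a < m \<Longrightarrow> x a > 0"
    and r: "r = vec m (\<lambda>a. 1 / (x a)\<^sup>2)" and \<chi>: "\<chi> = A *\<^sub>v vec m (\<lambda>a. x a * g a)"
    and g: "\<epsilon> * (\<Sum>a<m. (g a)\<^sup>2) \<le> 1 / 16" and \<epsilon>: "\<epsilon> > 0"
    and f: "eps_electrical_flow \<epsilon> A r \<chi> f" and \<pi>: "eps_voltages \<epsilon> A r \<chi> \<pi>"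
    and large: "(\<Sum>a<m. (g a - x a * (A\<^sup>T *\<^sub>v \<pi>) $ a)\<^sup>2) > 9/64"
  shows "(\<Sum>a<m. g a * (g a - f $ a / x a)) \<ge> (\<Sum>a<m. (g a - f $ a / x a)\<^sup>2) / 2 + 1 / 128"
proof -
  have AT: "A\<^sup>T \<in> carrier_mat m n" using A by simp
  have r': "r \<in> carrier_vec m" "\<And>a. a < m \<Longrightarrow> r $ a > 0" using x by (auto simp: r) force
  have \<chi>': "\<chi> \<in> carrier_vec n" using A by (simp add: \<chi>)
  from \<pi> A have \<pi>c: "\<pi> \<in> carrier_vec n" by (simp add: eps_voltages_def)
  from \<pi> obtain \<pi>o where opt: "optimal_voltages A r \<chi> \<pi>o"
    and close: "sq_norm_wrt (weighted_laplacian A r) (\<pi> - \<pi>o) \<le> \<epsilon> * sq_norm_wrt (weighted_laplacian A r) \<pi>o"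
    by (auto simp: eps_voltages_def)
  have \<pi>oc: "\<pi>o \<in> carrier_vec n" using opt A by (simp add: optimal_voltages_def)
  from f A have fc: "f \<in> carrier_vec m" and fA: "A *\<^sub>v f = \<chi>" by (auto simp: eps_electrical_flow_def)
  from f obtain fo where fo: "electrical_flow A r \<chi> fo"
    and fle: "sq_norm_wrt (resistance_mat r) f \<le> (1 + \<epsilon>) * sq_norm_wrt (resistance_mat r) fo"
    by (auto simp: eps_electrical_flow_def)
  define p where "p a = x a * (A\<^sup>T *\<^sub>v \<pi>) $ a" for a
  define po where "po a = x a * (A\<^sup>T *\<^sub>v \<pi>o) $ a" for a
  define u where "u a = f $ a / x a" for a
  have adj: "\<rho> \<bullet> (A *\<^sub>v w) = (\<Sum>a<m. (A\<^sup>T *\<^sub>v \<rho>) $ a * w $ a)"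
    if "\<rho> \<in> carrier_vec n" "w \<in> carrier_vec m" for \<rho> w
    using transpose_vec_mult_scalar[OF A that(2,1)] that A by (simp add: scalar_prod_def atLeast0LessThan)
  have g\<rho>: "\<rho> \<bullet> \<chi> = (\<Sum>a<m. g a * (x a * (A\<^sup>T *\<^sub>v \<rho>) $ a))" if "\<rho> \<in> carrier_vec n" for \<rho>
    unfolding \<chi> using adj[OF that, of "vec m (\<lambda>a. x a * g a)"] by (simp add: ac_simps)
  have u\<rho>: "\<rho> \<bullet> \<chi> = (\<Sum>a<m. u a * (x a * (A\<^sup>T *\<^sub>v \<rho>) $ a))" if "\<rho> \<in> carrier_vec n" for \<rho>
    unfolding fA[symmetric] adj[OF that fc] using x by (intro sum.cong) (force simp: u_def)+
  have po\<rho>: "\<rho> \<bullet> \<chi> = (\<Sum>a<m. po a * (x a * (A\<^sup>T *\<^sub>v \<rho>) $ a))" if "\<rho> \<in> carrier_vec n" for \<rho>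
    using optimal_voltages_normal_equation[OF A r'(1) _ \<chi>' opt that] r'(2)
    by (simp add: r po_def power2_eq_square ac_simps)
  have o1: "(\<Sum>a<m. (g a - u a) * po a) = 0"
    using g\<rho>[OF \<pi>oc] u\<rho>[OF \<pi>oc] by (simp add: po_def[symmetric] left_diff_distrib sum_subtractf)
  have o2: "(\<Sum>a<m. (g a - po a) * po a) = 0"
    using g\<rho>[OF \<pi>oc] po\<rho>[OF \<pi>oc] by (simp add: po_def[symmetric] left_diff_distrib sum_subtractf)
  have o3: "(\<Sum>a<m. (g a - po a) * p a) = 0"
    using g\<rho>[OF \<pi>c] po\<rho>[OF \<pi>c] by (simp add: p_def[symmetric] left_diff_distrib sum_subtractf)
  have po_le: "(\<Sum>a<m. (po a)\<^sup>2) \<le> (\<Sum>a<m. (g a)\<^sup>2)"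
  proof -
    have "0 \<le> (\<Sum>a<m. (g a - po a)\<^sup>2)" by (intro sum_nonneg) auto
    also have "\<dots> = (\<Sum>a<m. (g a)\<^sup>2 - (po a)\<^sup>2 - 2 * ((g a - po a) * po a))"
      by (intro sum.cong) (simp_all add: power2_eq_square algebra_simps)
    also have "\<dots> = (\<Sum>a<m. (g a)\<^sup>2) - (\<Sum>a<m. (po a)\<^sup>2) - 2 * (\<Sum>a<m. (g a - po a) * po a)"
      by (simp only: sum_subtractf sum_distrib_left)
    finally show ?thesis using o2 by simp
  qed
  then have \<epsilon>po: "\<epsilon> * (\<Sum>a<m. (po a)\<^sup>2) \<le> 1 / 16"
    using g \<epsilon> by (meson mult_left_mono less_imp_le order_trans)
  have norm_po: "sq_norm_wrt (weighted_laplacian A r) \<pi>o = (\<Sum>a<m. (po a)\<^sup>2)"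
    unfolding sq_norm_wrt_def scalar_prod_weighted_laplacian[OF A r'(1) \<pi>oc \<pi>oc]
    by (intro sum.cong) (auto simp: r po_def power2_eq_square)
  have "sq_norm_wrt (weighted_laplacian A r) (\<pi> - \<pi>o) = (\<Sum>a<m. (p a - po a)\<^sup>2)"
  proof -
    have c: "\<pi> - \<pi>o \<in> carrier_vec n" using \<pi>c \<pi>oc by simp
    show ?thesis unfolding sq_norm_wrt_def scalar_prod_weighted_laplacian[OF A r'(1) c c]
      using A by (intro sum.cong)
       (auto simp: mult_minus_distrib_mat_vec[OF AT \<pi>c \<pi>oc] r p_def po_def power2_eq_square algebra_simps)
  qed
  with close norm_po \<epsilon>po have p: "(\<Sum>a<m. (p a - po a)\<^sup>2) \<le> 1/16" by simp
  have u: "(\<Sum>a<m. (u a)\<^sup>2) \<le> (\<Sum>a<m. (po a)\<^sup>2) + 1/16"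
  proof -
    \<comment> \<open>The flow that Ohm's law assigns to the optimal voltages. Testing the normal
      equation with unit vectors shows that it is feasible, so its energy bounds the minimum from
      above; this is the direction of strong duality that is required.\<close>
    define h where "h = vec m (\<lambda>a. x a * po a)"
    have h: "h \<in> carrier_vec m" by (simp add: h_def)
    have "A *\<^sub>v h = \<chi>"
    proof (rule eq_vecI)
      fix v assume "v < dim_vec \<chi>"
      then have v: "v < n" using \<chi>' by simp
      have Ah: "A *\<^sub>v h \<in> carrier_vec n" using A h by simp
      have "unit_vec n v \<bullet> (A *\<^sub>v h) = unit_vec n v \<bullet> \<chi>"
        unfolding po\<rho>[OF unit_vec_carrier] adj[OF unit_vec_carrier h]
        by (intro sum.cong) (auto simp: h_def)
      then show "(A *\<^sub>v h) $ v = \<chi> $ v" using v Ah \<chi>' by (simp add: scalar_prod_left_unit[of _ n])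
    qed (use A h \<chi>' in auto)
    then have "sq_norm_wrt (resistance_mat r) fo \<le> sq_norm_wrt (resistance_mat r) h"
      using fo h A by (simp add: electrical_flow_def)
    also have "\<dots> = (\<Sum>a<m. (po a)\<^sup>2)" unfolding sq_norm_wrt_resistance_mat[OF r'(1) h]
      using x by (intro sum.cong) (force simp: r h_def power_mult_distrib)+
    finally have "(1 + \<epsilon>) * sq_norm_wrt (resistance_mat r) fo \<le> (1 + \<epsilon>) * (\<Sum>a<m. (po a)\<^sup>2)"
      using \<epsilon> by (intro mult_left_mono) auto
    moreover have "sq_norm_wrt (resistance_mat r) f = (\<Sum>a<m. (u a)\<^sup>2)"
      unfolding sq_norm_wrt_resistance_mat[OF r'(1) fc]
      by (intro sum.cong) (auto simp: r u_def power_divide)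
    ultimately show ?thesis using fle \<epsilon>po by (simp add: algebra_simps)
  qed
  show ?thesis using descent_of_projections[OF o1 o2 o3 p u] large by (simp add: p_def u_def)
qed

section \<open>The two steps in rational arithmetic\<close>

section \<open>Rational data\<close>

definition gap :: "nat \<Rightarrow> (nat \<Rightarrow> rat) \<Rightarrow> (nat \<Rightarrow> rat) \<Rightarrow> rat" where
  "gap m x s = (\<Sum>a<m. x a * s a)"

definition scaled_gradient :: "nat \<Rightarrow> nat \<Rightarrow> (nat \<Rightarrow> rat) \<Rightarrow> (nat \<Rightarrow> rat) \<Rightarrow> nat \<Rightarrow> rat" where
  "scaled_gradient q m x s a = of_nat q * (x a * s a) / gap m x s - 1"

definition incidence :: "(nat \<Rightarrow> nat) \<Rightarrow> (nat \<Rightarrow> nat) \<Rightarrow> nat \<Rightarrow> nat \<Rightarrow> 'a::ring_1" where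
  "incidence h t v a = (if h a = v then 1 else 0) - (if t a = v then 1 else 0)"

text \<open>Coordinate v of the product of the incidence matrix with f, on functions, so that it
  applies to array contents and, by its polymorphism, to their real images.\<close>

definition net_inflow :: "(nat \<Rightarrow> nat) \<Rightarrow> (nat \<Rightarrow> nat) \<Rightarrow> (nat \<Rightarrow> 'a::ring_1) \<Rightarrow> nat \<Rightarrow> nat \<Rightarrow> 'a" where
  "net_inflow h t f m v = (\<Sum>a<m. incidence h t v a * f a)"

definition flow_direction ::
    "nat \<Rightarrow> nat \<Rightarrow> (nat \<Rightarrow> rat) \<Rightarrow> (nat \<Rightarrow> rat) \<Rightarrow> (nat \<Rightarrow> rat) \<Rightarrow> nat \<Rightarrow> rat" where
  "flow_direction q m x s f a = scaled_gradient q m x s a - f a / x a"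

definition voltage_direction ::
    "(nat \<Rightarrow> nat) \<Rightarrow> (nat \<Rightarrow> nat) \<Rightarrow> nat \<Rightarrow> nat \<Rightarrow> (nat \<Rightarrow> rat) \<Rightarrow> (nat \<Rightarrow> rat) \<Rightarrow> (nat \<Rightarrow> rat) \<Rightarrow> nat \<Rightarrow> rat"
  where
  "voltage_direction h t q m x s \<pi> a = scaled_gradient q m x s a - x a * (\<pi> (h a) - \<pi> (t a))"

definition sq_sum :: "(nat \<Rightarrow> rat) \<Rightarrow> nat \<Rightarrow> rat" where
  "sq_sum d m = (\<Sum>a<m. d a * d a)"

text \<open>
  The thresholds are chosen such that both steps are proved to decrease the potential by a constant
  from the single bound \<open>\<bar>ln (1 + d) - d\<bar> \<le> 2 * d\<^sup>2\<close>; dividing by \<open>NF + 1\<close> avoids the square root in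
  the normalisation of the direction.
\<close>

definition primal_step :: "rat \<Rightarrow> rat \<Rightarrow> rat" where
  "primal_step NP NF = (if 9 / 64 < NP then 1 / (128 * (NF + 1)) else 0)"

definition dual_step :: "rat \<Rightarrow> rat \<Rightarrow> rat" where
  "dual_step NP D = (if 9 / 64 < NP then 0 else D)"

abbreviation of_rat_fun :: "(nat \<Rightarrow> rat) \<Rightarrow> nat \<Rightarrow> real" where
  "of_rat_fun x \<equiv> \<lambda>a. real_of_rat (x a)"

lemma potential_parameter_split: "\<exists>k. potential_parameter m = m + k \<and> m \<le> k\<^sup>2"
proof -
  have "m \<le> m\<^sup>2" by (simp add: power2_eq_square)
  then have "m \<le> (LEAST k. m \<le> k\<^sup>2)\<^sup>2" by (rule LeastI)
  then show ?thesis unfolding potential_parameter_def by blast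
qed

lemma of_rat_sum_fun: "real_of_rat (\<Sum>a\<in>S. f a) = (\<Sum>a\<in>S. real_of_rat (f a))"
  by (induction S rule: infinite_finite_induct) (auto simp: of_rat_add)

lemma numbered_digraph_bounds:
  assumes "numbered_digraph n m G" "a < m"
  shows "head G a < n" "tail G a < n"
proof -
  interpret fin_digraph G using assms by (simp add: numbered_digraph_def)
  show "head G a < n" "tail G a < n"
    using assms head_in_verts[of a] tail_in_verts[of a] by (auto simp: numbered_digraph_def)
qed

lemma incidence_mat_carrier [simp]: "incidence_mat n m G \<in> carrier_mat n m"
  by (simp add: incidence_mat_def)

lemma incidence_mat_dims: "dim_col (incidence_mat n m G) = m" "dim_row (incidence_mat n m G) = n"
  by (simp_all add: incidence_mat_def)

lemma incidence_mat_mult_vec: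
  assumes "f \<in> carrier_vec m" "v < n"
  shows "(incidence_mat n m G *\<^sub>v f) $ v = net_inflow (head G) (tail G) (\<lambda>a. f $ a) m v"
  using assms
  by (auto simp: incidence_mat_def net_inflow_def incidence_def scalar_prod_def atLeast0LessThan intro!: sum.cong)

lemma sum_incidence_mult:
  fixes p :: "nat \<Rightarrow> 'a::comm_ring_1"
  assumes "h a < n" "t a < n"
  shows "(\<Sum>v<n. incidence h t v a * p v) = p (h a) - p (t a)"
  using assms by (simp add: incidence_def left_diff_distrib sum_subtractf if_distrib[of "\<lambda>z. z * _"] cong: if_cong)

lemma incidence_mat_transpose_mult_vec:
  fixes p :: "'a::comm_ring_1 vec"
  assumes "numbered_digraph n m G" "p \<in> carrier_vec n" "a < m"
  shows "((incidence_mat n m G)\<^sup>T *\<^sub>v p) $ a = p $ (head G a) - p $ (tail G a)"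
proof -
  have "((incidence_mat n m G)\<^sup>T *\<^sub>v p) $ a = (\<Sum>v<n. incidence (head G) (tail G) v a * p $ v)"
    using assms(2,3)
    by (auto simp: incidence_mat_def incidence_def scalar_prod_def atLeast0LessThan intro!: sum.cong)
  also have "\<dots> = p $ (head G a) - p $ (tail G a)"
    using numbered_digraph_bounds[OF assms(1,3)] by (rule sum_incidence_mult)
  finally show ?thesis .
qed

lemma of_rat_net_inflow:
  "real_of_rat (net_inflow h t f m v) = net_inflow h t (of_rat_fun f) m v"
  by (auto simp: net_inflow_def of_rat_sum_fun of_rat_mult incidence_def of_rat_diff intro!: sum.cong)

lemma sum_net_inflow:
  fixes f :: "nat \<Rightarrow> rat"
  assumes "\<And>a. a < m \<Longrightarrow> h a < n" "\<And>a. a < m \<Longrightarrow> t a < n"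
  shows "(\<Sum>v<n. net_inflow h t f m v) = 0"
proof -
  have "(\<Sum>v<n. net_inflow h t f m v) = (\<Sum>a<m. f a * (\<Sum>v<n. incidence h t v a * 1))"
    unfolding net_inflow_def by (subst sum.swap) (simp add: sum_distrib_left mult.commute)
  also have "\<dots> = (\<Sum>a<m. f a * (1 - 1))"
    by (intro sum.cong refl) (use assms in \<open>simp add: sum_incidence_mult[where p = "\<lambda>_. 1", simplified]\<close>)
  finally show ?thesis by simp
qed

text \<open>Collects what one iteration uses of the specification of \<open>E\<close>, phrased with
  lists and rational functions as the program handles them. The descent inequality is conditional on
  the very test that the program performs.\<close>

lemma electrical_algorithm_step:
  fixes x s :: "nat \<Rightarrow> rat"
  assumes E: "certifying_electrical_flow_algorithm E CEF" and G: "numbered_digraph n m G" and m: "m \<ge> 1"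
    and x: "\<And>a. a < m \<Longrightarrow> x a > 0" and s: "\<And>a. a < m \<Longrightarrow> s a > 0"
  defines "h \<equiv> head G" and "t \<equiv> tail G" and "q \<equiv> potential_parameter m"
  defines "g \<equiv> scaled_gradient q m x s"
  obtains f \<pi> T where
    "computes_in_time E
       (encode_digraph n m G @ map (\<lambda>a. 1 / (x a * x a)) [0..<m]
         @ map (net_inflow h t (\<lambda>a. x a * g a) m) [0..<n] @ [1 / (16 * (of_nat q)\<^sup>2)])
       (map f [0..<m] @ map \<pi> [0..<n]) T"
    and "real T \<le> CEF n m (1 / (16 * (of_nat q)\<^sup>2))"
    and "\<And>v. v < n \<Longrightarrow> net_inflow h t f m v = net_inflow h t (\<lambda>a. x a * g a) m v"
    and "9 / 64 < sq_sum (voltage_direction h t q m x s \<pi>) m \<Longrightarrow>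
      (\<Sum>a<m. of_rat_fun g a * of_rat_fun (flow_direction q m x s f) a) \<ge>
      real_of_rat (sq_sum (flow_direction q m x s f) m) / 2 + 1 / 128"
proof -
  define \<epsilon> :: rat where "\<epsilon> = 1 / (16 * (of_nat q)\<^sup>2)"
  define A :: "real mat" where "A = incidence_mat n m G"
  define r where "r = vec m (\<lambda>a. 1 / (x a * x a))"
  define \<chi> where "\<chi> = vec n (net_inflow h t (\<lambda>a. x a * g a) m)"
  define xr where "xr = of_rat_fun x"
  define sr where "sr = of_rat_fun s"
  define gr where "gr = of_rat_fun g"
  have A: "A \<in> carrier_mat n m" by (simp add: A_def)
  obtain k where k: "q = m + k" "m \<le> k\<^sup>2" using potential_parameter_split[of m] by (auto simp: q_def)
  have q0: "q > 0" using k m by simp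
  have \<epsilon>0: "\<epsilon> > 0" using q0 by (simp add: \<epsilon>_def)
  have xr: "xr a > 0" if "a < m" for a using x[OF that] by (simp add: xr_def)
  have sr: "sr a > 0" if "a < m" for a using s[OF that] by (simp add: sr_def)
  have gr: "gr a = real q * (xr a * sr a) / (\<Sum>a<m. xr a * sr a) - 1" for a
    by (simp add: gr_def xr_def sr_def g_def scaled_gradient_def gap_def of_rat_diff of_rat_divide of_rat_mult of_rat_sum_fun)
  have \<chi>r: "real_vec \<chi> = A *\<^sub>v vec m (\<lambda>a. xr a * gr a)"
  proof (rule eq_vecI)
    fix v assume "v < dim_vec (A *\<^sub>v vec m (\<lambda>a. xr a * gr a))"
    then have v: "v < n" using A by simp
    have "(A *\<^sub>v vec m (\<lambda>a. xr a * gr a)) $ v =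
        net_inflow h t (\<lambda>a. vec m (\<lambda>a. xr a * gr a) $ a) m v"
      unfolding A_def h_def t_def using v by (intro incidence_mat_mult_vec) auto
    also have "\<dots> = net_inflow h t (of_rat_fun (\<lambda>a. x a * g a)) m v"
      unfolding net_inflow_def by (intro sum.cong) (auto simp: xr_def gr_def of_rat_mult)
    finally show "real_vec \<chi> $ v = (A *\<^sub>v vec m (\<lambda>a. xr a * gr a)) $ v"
      using v by (simp add: \<chi>_def of_rat_net_inflow)
  qed (use A in \<open>auto simp: \<chi>_def\<close>)
  have rr: "real_vec r = vec m (\<lambda>a. 1 / (xr a)\<^sup>2)"
    by (intro eq_vecI) (auto simp: r_def xr_def of_rat_divide of_rat_mult power2_eq_square)
  have inst: "electrical_instance n m G r \<chi>"
    unfolding electrical_instance_def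
  proof (intro conjI)
    show "\<forall>a<m. r $ a > 0" using x by (simp add: r_def)
    show "(\<Sum>v<n. \<chi> $ v) = 0"
      using sum_net_inflow[of m h n t "\<lambda>a. x a * g a"] numbered_digraph_bounds[OF G]
      by (simp add: \<chi>_def h_def t_def)
    \<comment> \<open>The currents are by definition those of the vector X g, which therefore
      witnesses that the instance is solvable even in a disconnected graph.\<close>
    show "\<exists>f\<in>carrier_vec m. incidence_mat n m G *\<^sub>v f = real_vec \<chi>"
      using \<chi>r A_def by (intro bexI[of _ "vec m (\<lambda>a. xr a * gr a)"]) auto
  qed (use G in \<open>auto simp: r_def \<chi>_def\<close>)
  from E[unfolded certifying_electrical_flow_algorithm_def, rule_format, OF conjI[OF inst \<epsilon>0]]
  obtain f \<pi> T where
    T: "computes_in_time E (encode_digraph n m G @ list_of_vec r @ list_of_vec \<chi> @ [\<epsilon>])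
             (list_of_vec f @ list_of_vec \<pi>) T" "real T \<le> CEF n m \<epsilon>"
    and f: "eps_electrical_flow (real_of_rat \<epsilon>) A (real_vec r) (real_vec \<chi>) (real_vec f)"
    and \<pi>: "eps_voltages (real_of_rat \<epsilon>) A (real_vec r) (real_vec \<chi>) (real_vec \<pi>)"
    unfolding A_def by auto
  have "real_vec f \<in> carrier_vec (dim_col A)" and fA: "A *\<^sub>v real_vec f = real_vec \<chi>"
    using f unfolding eps_electrical_flow_def by blast+
  then have fc: "f \<in> carrier_vec m" using A by simp
  have "real_vec \<pi> \<in> carrier_vec (dim_row A)" using \<pi> unfolding eps_voltages_def by blast
  then have \<pi>c: "\<pi> \<in> carrier_vec n" using A by simp
  define ff where "ff a = f $ a" for a
  define pp where "pp a = \<pi> $ a" for a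
  have lists: "list_of_vec r = map (\<lambda>a. 1 / (x a * x a)) [0..<m]"
    "list_of_vec \<chi> = map (net_inflow h t (\<lambda>a. x a * g a) m) [0..<n]"
    "list_of_vec f = map ff [0..<m]" "list_of_vec \<pi> = map pp [0..<n]"
    using fc \<pi>c by (auto simp: r_def \<chi>_def ff_def pp_def list_eq_iff_nth_eq list_of_vec_index)
  have cons: "net_inflow h t ff m v = net_inflow h t (\<lambda>a. x a * g a) m v" if "v < n" for v
  proof -
    have "real_of_rat (net_inflow h t ff m v) = (A *\<^sub>v real_vec f) $ v"
      unfolding A_def of_rat_net_inflow using that fc
      by (subst incidence_mat_mult_vec) (auto simp: h_def t_def ff_def net_inflow_def intro!: sum.cong)
    also have "\<dots> = real_of_rat (\<chi> $ v)" unfolding fA using that by (simp add: \<chi>_def)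
    finally show ?thesis using that by (simp add: \<chi>_def)
  qed
  have desc: "(\<Sum>a<m. of_rat_fun g a * of_rat_fun (flow_direction q m x s ff) a) \<ge>
      real_of_rat (sq_sum (flow_direction q m x s ff) m) / 2 + 1 / 128"
    if "9 / 64 < sq_sum (voltage_direction h t q m x s pp) m"
  proof -
    have fd: "real_of_rat (flow_direction q m x s ff a) = gr a - real_vec f $ a / xr a" if "a < m" for a
      using that fc by (simp add: flow_direction_def g_def[symmetric] gr_def xr_def ff_def of_rat_diff of_rat_divide)
    have vd: "real_of_rat (voltage_direction h t q m x s pp a) = gr a - xr a * (A\<^sup>T *\<^sub>v real_vec \<pi>) $ a"
      if "a < m" for a
      unfolding A_def
      using that \<pi>c numbered_digraph_bounds[OF G that]
      by (subst incidence_mat_transpose_mult_vec[OF G])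
        (auto simp: voltage_direction_def g_def[symmetric] gr_def xr_def pp_def h_def t_def of_rat_diff of_rat_mult)
    have sqs: "real_of_rat (sq_sum d m) = (\<Sum>a<m. (of_rat_fun d a)\<^sup>2)" for d
      by (simp add: sq_sum_def of_rat_sum_fun of_rat_mult power2_eq_square)
    have "real_of_rat (9 / 64) < real_of_rat (sq_sum (voltage_direction h t q m x s pp) m)"
      using that by (simp only: of_rat_less)
    also have "\<dots> = (\<Sum>a<m. (gr a - xr a * (A\<^sup>T *\<^sub>v real_vec \<pi>) $ a)\<^sup>2)"
      unfolding sqs by (intro sum.cong) (auto simp: vd)
    finally have large: "9 / 64 < (\<Sum>a<m. (gr a - xr a * (A\<^sup>T *\<^sub>v real_vec \<pi>) $ a)\<^sup>2)"
      by (simp add: of_rat_divide)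
    have "(\<Sum>a<m. (gr a)\<^sup>2) \<le> (real q)\<^sup>2"
      unfolding gr using m k xr sr by (intro gradient_norm_le) auto
    then have "real_of_rat \<epsilon> * (\<Sum>a<m. (gr a)\<^sup>2) \<le> real_of_rat \<epsilon> * (real q)\<^sup>2"
      using \<epsilon>0 by (intro mult_left_mono) auto
    also have "\<dots> = 1 / 16"
      using q0 by (simp add: \<epsilon>_def of_rat_divide of_rat_mult of_rat_power)
    finally have g16: "real_of_rat \<epsilon> * (\<Sum>a<m. (gr a)\<^sup>2) \<le> 1 / 16" .
    from electrical_step_descent[OF A xr rr \<chi>r g16 _ f \<pi> large] \<epsilon>0
    have "(\<Sum>a<m. gr a * (gr a - real_vec f $ a / xr a)) \<ge>
      (\<Sum>a<m. (gr a - real_vec f $ a / xr a)\<^sup>2) / 2 + 1 / 128" by simp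
    moreover have "(\<Sum>a<m. gr a * (gr a - real_vec f $ a / xr a)) =
      (\<Sum>a<m. of_rat_fun g a * of_rat_fun (flow_direction q m x s ff) a)"
      by (intro sum.cong) (auto simp: fd gr_def)
    moreover have "(\<Sum>a<m. (gr a - real_vec f $ a / xr a)\<^sup>2) =
      real_of_rat (sq_sum (flow_direction q m x s ff) m)"
      unfolding sqs by (intro sum.cong) (auto simp: fd)
    ultimately show ?thesis by simp
  qed
  show ?thesis by (rule that[OF T(1)[unfolded lists \<epsilon>_def] T(2)[unfolded \<epsilon>_def] cons desc])
qed

text \<open>Both updates are always applied, but one of the step sizes is zero, so one of the points
  stays put. The guaranteed decrease is the smaller of those for the two steps.\<close>

lemma potential_reduction:
  fixes x s f \<pi> :: "nat \<Rightarrow> rat"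
  assumes m: "m \<ge> 1" and x: "\<And>a. a < m \<Longrightarrow> x a > 0" and s: "\<And>a. a < m \<Longrightarrow> s a > 0"
    and q: "q = potential_parameter m"
    and flow: "\<And>v. v < n \<Longrightarrow> net_inflow h t f m v = net_inflow h t (\<lambda>a. x a * scaled_gradient q m x s a) m v"
    and d: "d = flow_direction q m x s f"
    and NP: "NP = sq_sum (voltage_direction h t q m x s \<pi>) m" and NF: "NF = sq_sum d m"
    and desc: "9 / 64 < NP \<Longrightarrow>
      (\<Sum>a<m. of_rat_fun (scaled_gradient q m x s) a * of_rat_fun d a) \<ge> real_of_rat NF / 2 + 1 / 128"
    and x': "\<And>a. a < m \<Longrightarrow> x' a = x a * (1 - primal_step NP NF * d a)"
    and s': "\<And>a. a < m \<Longrightarrow> s' a = s a - dual_step NP (gap m x s / of_nat q) * (\<pi> (h a) - \<pi> (t a))"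
  shows "\<And>a. a < m \<Longrightarrow> x' a > 0" and "\<And>a. a < m \<Longrightarrow> s' a > 0"
    and "\<And>v. v < n \<Longrightarrow> net_inflow h t x' m v = net_inflow h t x m v"
    and "pot q m (of_rat_fun x') (of_rat_fun s') \<le> pot q m (of_rat_fun x) (of_rat_fun s) - 1 / 32768"
proof -
  obtain k where k: "q = m + k" "m \<le> k\<^sup>2" using potential_parameter_split[of m] by (auto simp: q)
  define xr where "xr = of_rat_fun x"
  define sr where "sr = of_rat_fun s"
  define D where "D = (\<Sum>a<m. xr a * sr a)"
  have xr: "xr a > 0" if "a < m" for a using x[OF that] by (simp add: xr_def)
  have sr: "sr a > 0" if "a < m" for a using s[OF that] by (simp add: sr_def)
  have gr: "of_rat_fun (scaled_gradient q m x s) a = real q * (xr a * sr a) / D - 1" for a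
    by (simp add: D_def xr_def sr_def scaled_gradient_def gap_def of_rat_diff of_rat_divide of_rat_mult of_rat_sum_fun)
  have sqs: "real_of_rat (sq_sum d m) = (\<Sum>a<m. (of_rat_fun d a)\<^sup>2)" for d
    by (simp add: sq_sum_def of_rat_sum_fun of_rat_mult power2_eq_square)
  have Dr: "D = real_of_rat (gap m x s)" by (simp add: D_def gap_def xr_def sr_def of_rat_sum_fun of_rat_mult)
  show "net_inflow h t x' m v = net_inflow h t x m v" if "v < n" for v
  proof -
    \<comment> \<open>The change is a multiple of X g - f, a circulation because f carries the
      currents of X g.\<close>
    have "x' a = x a - primal_step NP NF * (x a * scaled_gradient q m x s a - f a)" if "a < m" for a
    proof -
      have "x a * d a = x a * scaled_gradient q m x s a - f a"
        using x[OF that] by (simp add: d flow_direction_def right_diff_distrib)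
      moreover have "x' a = x a - primal_step NP NF * (x a * d a)"
        using x'[OF that] by (simp add: right_diff_distrib mult.left_commute)
      ultimately show ?thesis by simp
    qed
    then have "net_inflow h t x' m v =
        (\<Sum>a<m. incidence h t v a * (x a - primal_step NP NF * (x a * scaled_gradient q m x s a - f a)))"
      unfolding net_inflow_def by (intro sum.cong) auto
    also have "\<dots> = (\<Sum>a<m. incidence h t v a * x a -
        primal_step NP NF * (incidence h t v a * (x a * scaled_gradient q m x s a) - incidence h t v a * f a))"
      by (intro sum.cong) (simp_all add: algebra_simps)
    also have "\<dots> = net_inflow h t x m v - primal_step NP NF *
        (net_inflow h t (\<lambda>a. x a * scaled_gradient q m x s a) m v - net_inflow h t f m v)"
      by (simp add: net_inflow_def sum_subtractf sum_distrib_left right_diff_distrib)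
    finally show ?thesis using flow[OF \<open>v < n\<close>] by simp
  qed
  have "(\<forall>a<m. x' a > 0) \<and> (\<forall>a<m. s' a > 0) \<and>
    pot q m (of_rat_fun x') (of_rat_fun s') \<le> pot q m (of_rat_fun x) (of_rat_fun s) - 1 / 32768"
  proof (cases "9 / 64 < NP")
    case True
    have ss: "s' a = s a" if "a < m" for a using s'[OF that] True by (simp add: dual_step_def)
    have pp: "pot q m z (of_rat_fun s') = pot q m z sr" for z
      using ss by (simp add: pot_def sr_def)
    have x'': "of_rat_fun x' a = xr a * (1 - (1 / (128 * (real_of_rat NF + 1))) * of_rat_fun d a)" if "a < m" for a
      using x'[OF that] True by (simp add: xr_def primal_step_def of_rat_mult of_rat_diff of_rat_divide of_rat_add)
    have desc': "real_of_rat NF / 2 + 1 / 128 \<le> (\<Sum>a<m. (real q * (xr a * sr a) / D - 1) * of_rat_fun d a)"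
      using desc[OF True] by (simp add: gr)
    have "q > 0" using k m by simp
    from primal_step_decreases_pot[OF m this xr sr D_def sqs[of d, folded NF] desc' refl x'']
    show ?thesis using ss s by (auto simp: pp xr_def sr_def)
  next
    case False
    have xx: "x' a = x a" if "a < m" for a using x'[OF that] False by (simp add: primal_step_def)
    have pp: "pot q m (of_rat_fun x') z = pot q m xr z" for z
      using xx by (simp add: pot_def xr_def)
    define v where "v a = real_of_rat (\<pi> (h a) - \<pi> (t a))" for a
    have s'': "of_rat_fun s' a = sr a - D / real q * v a" if "a < m" for a
      using s'[OF that] False by (simp add: sr_def dual_step_def v_def Dr of_rat_mult of_rat_diff of_rat_divide)
    have "real_of_rat NP \<le> real_of_rat (9 / 64)" using False by (simp only: of_rat_less_eq not_less)
    moreover have "real_of_rat NP = (\<Sum>a<m. (real q * (xr a * sr a) / D - 1 - xr a * v a)\<^sup>2)"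
      unfolding NP sqs by (simp add: voltage_direction_def of_rat_diff[of "scaled_gradient q m x s _"] gr of_rat_mult v_def xr_def)
    ultimately have small: "(\<Sum>a<m. (real q * (xr a * sr a) / D - 1 - xr a * v a)\<^sup>2) \<le> 9 / 64"
      by (simp add: of_rat_divide)
    from dual_step_decreases_pot[OF m k(2,1) xr sr D_def small s'']
    show ?thesis using xx x by (auto simp: pp xr_def sr_def)
  qed
  then show "\<And>a. a < m \<Longrightarrow> x' a > 0" and "\<And>a. a < m \<Longrightarrow> s' a > 0"
    and "pot q m (of_rat_fun x') (of_rat_fun s') \<le> pot q m (of_rat_fun x) (of_rat_fun s) - 1 / 32768"
    by auto
qed

section \<open>Addresses, memory layout and code\<close>

section \<open>The program\<close>

text \<open>A separate name for the address conversion lets simplification push it through sums and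
  products of naturals without meeting \<open>nat\<close> and the floor.\<close>

definition index :: "rat \<Rightarrow> nat" where
  "index v = nat \<lfloor>v\<rfloor>"

lemma index_simps [simp]:
  "index (of_nat k) = k" "index 0 = 0" "index 1 = 1" "index (numeral w) = numeral w"
  "v \<in> \<nat> \<Longrightarrow> w' \<in> \<nat> \<Longrightarrow> index (v + w') = index v + index w'"
  "v \<in> \<nat> \<Longrightarrow> w' \<in> \<nat> \<Longrightarrow> index (v * w') = index v * index w'"
  by (auto simp: index_def elim!: Nats_cases simp flip: of_nat_add of_nat_mult)

lemma eval_Cell_index:
  "eval (Cell a e) \<sigma> =
     (case eval e \<sigma> of
        None \<Rightarrow> None
      | Some v \<Rightarrow> if v \<in> \<nat> then Some (\<sigma> a (index v)) else None)"
  by (auto simp: index_def split: option.split)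

lemma sem_Assign_index:
  "sem (Assign a i e) \<sigma> =
     (case (eval i \<sigma>, eval e \<sigma>) of
        (Some k, Some v) \<Rightarrow> if k \<in> \<nat> then Some (\<sigma>(a := (\<sigma> a)(index k := v))) else None
      | _ \<Rightarrow> None)"
  by (auto simp: index_def split: option.split)

declare eval.simps(2) [simp del] eval_Cell_index [simp]
declare sem.simps(2) [simp del] sem_Assign_index [simp]
text \<open>Array indices stay sums in which the offsets 1 and 2 are not turned into successors.\<close>

declare One_nat_def [simp del] add_2_eq_Suc [simp del] add_2_eq_Suc' [simp del]

text \<open>
  The subroutine uses array names below \<open>K + 4\<close> only. The arrays \<open>nN\<close>, \<open>nM\<close>, \<open>nT\<close>, \<open>nH\<close> hold the graph,
  \<open>nX\<close>, \<open>nS\<close>, \<open>nY\<close> the current point, \<open>nQ\<close> the parameter \<open>q\<close>, \<open>nD\<close> the duality gap, \<open>nF\<close> whether it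
  is at least 1, \<open>nI\<close> the loop counter, \<open>nG\<close> the scaled gradient, \<open>nDF\<close> the primal direction, \<open>nNF\<close>
  and \<open>nNP\<close> the squared norms of the two directions, \<open>nA\<close> and \<open>nB\<close> the step sizes.
\<close>

context
  fixes K :: nat
begin

abbreviation (input) "nN \<equiv> K + 4"
abbreviation (input) "nM \<equiv> K + 5"
abbreviation (input) "nT \<equiv> K + 6"
abbreviation (input) "nH \<equiv> K + 7"
abbreviation (input) "nX \<equiv> K + 8"
abbreviation (input) "nS \<equiv> K + 9"
abbreviation (input) "nY \<equiv> K + 10"
abbreviation (input) "nQ \<equiv> K + 11"
abbreviation (input) "nD \<equiv> K + 12"
abbreviation (input) "nF \<equiv> K + 13"
abbreviation (input) "nI \<equiv> K + 14"
abbreviation (input) "nG \<equiv> K + 15"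
abbreviation (input) "nDF \<equiv> K + 16"
abbreviation (input) "nNF \<equiv> K + 17"
abbreviation (input) "nNP \<equiv> K + 18"
abbreviation (input) "nA \<equiv> K + 19"
abbreviation (input) "nB \<equiv> K + 20"
text \<open>Scratch cell: it holds x a times the gradient while the input of the call is written,
  and later one coordinate of the voltage direction.\<close>

abbreviation (input) "nW \<equiv> K + 21"

abbreviation (input) "iV \<equiv> Var nI"
abbreviation (input) "nV \<equiv> Var nN"
abbreviation (input) "mV \<equiv> Var nM"

definition read_sizes :: com where
  "read_sizes = Seq (Set nN (Cell 0 (Num 0))) (Seq (Set nM (Cell 0 (Num 1))) (Set nD (Num 0)))"

text \<open>The input consists of the blocks n, m, tails, heads, b, c, x, y, s, which determines the
  offsets. The blocks b and c are jumped over, since the steps preserve A x and A^T y + s.\<close>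

definition read_arc :: com where
  "read_arc =
     Seq (Assign nT iV (Cell 0 (Add (Num 2) iV)))
    (Seq (Assign nH iV (Cell 0 (Add (Add (Num 2) mV) iV)))
    (Seq (Assign nX iV (Cell 0 (Add (Add (Add (Num 2) (Mul (Num 3) mV)) nV) iV)))
    (Seq (Assign nS iV (Cell 0 (Add (Add (Add (Num 2) (Mul (Num 4) mV)) (Mul (Num 2) nV)) iV)))
         (Set nD (Add (Var nD) (Mul (Cell nX iV) (Cell nS iV)))))))"

definition read_node :: com where
  "read_node = Assign nY iV (Cell 0 (Add (Add (Add (Num 2) (Mul (Num 4) mV)) nV) iV))"

text \<open>Counting up finds the rounded-up square root of m with comparisons only, in at most m
  rounds, hence in time linear in the input.\<close>

definition root_loop :: com where
  "root_loop = WhileLess (Mul (Var nQ) (Var nQ)) mV (Set nQ (Add (Var nQ) (Num 1)))"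

text \<open>Loops continue on a strict comparison, but here they must continue while the gap is at
  least 1, also at equality. The flag turns the negated test into a strict one.\<close>

definition set_flag :: com where
  "set_flag = IfLess (Var nD) (Num 1) (Set nF (Num 0)) (Set nF (Num 1))"

text \<open>Clearing first serves two ends: the subroutine finds the memory that its specification
  presupposes, and the currents can be accumulated starting from zero. The last assignment puts the
  precision behind the currents.\<close>

definition write_sizes :: com where
  "write_sizes =
     Seq (clear_below (K + 4))
    (Seq (Assign 0 (Num 0) nV)
    (Seq (Assign 0 (Num 1) mV)
         (Assign 0 (Add (Add (Num 2) (Mul (Num 3) mV)) nV)
            (Div (Num 1) (Mul (Num 16) (Mul (Var nQ) (Var nQ)))))))"

text \<open>The currents A X g are built up arc by arc, adding at the head and subtracting at the
  tail, in time O(m) instead of O(n m).\<close>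

abbreviation add_current :: "nat \<Rightarrow> exp \<Rightarrow> com" where
  "add_current v w \<equiv>
     Assign 0 (Add (Add (Num 2) (Mul (Num 3) mV)) (Cell v iV))
       (Add (Cell 0 (Add (Add (Num 2) (Mul (Num 3) mV)) (Cell v iV))) w)"

definition write_arc :: com where
  "write_arc =
     Seq (Assign nG iV (Sub (Div (Mul (Var nQ) (Mul (Cell nX iV) (Cell nS iV))) (Var nD)) (Num 1)))
    (Seq (Assign 0 (Add (Num 2) iV) (Cell nT iV))
    (Seq (Assign 0 (Add (Add (Num 2) mV) iV) (Cell nH iV))
    (Seq (Assign 0 (Add (Add (Num 2) (Mul (Num 2) mV)) iV)
            (Div (Num 1) (Mul (Cell nX iV) (Cell nX iV))))
    (Seq (Set nW (Mul (Cell nX iV) (Cell nG iV)))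
    (Seq (add_current nH (Var nW))
         (add_current nT (Sub (Num 0) (Var nW))))))))"

text \<open>The call leaves m flow values followed by n voltages in array 1, hence the offset
  m.\<close>

abbreviation voltage_drop :: exp where
  "voltage_drop \<equiv> Sub (Cell 1 (Add mV (Cell nH iV))) (Cell 1 (Add mV (Cell nT iV)))"

definition clear_norms :: com where
  "clear_norms = Seq (Set nNF (Num 0)) (Set nNP (Num 0))"

definition directions :: com where
  "directions =
     Seq (Assign nDF iV (Sub (Cell nG iV) (Div (Cell 1 iV) (Cell nX iV))))
    (Seq (Set nNF (Add (Var nNF) (Mul (Cell nDF iV) (Cell nDF iV))))
    (Seq (Set nW (Sub (Cell nG iV) (Mul (Cell nX iV) voltage_drop)))
         (Set nNP (Add (Var nNP) (Mul (Var nW) (Var nW))))))"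

text \<open>Exactly one of the step sizes is nonzero, so the updates need no case distinction.\<close>

definition step_sizes :: com where
  "step_sizes =
     Seq (IfLess (Num (9 / 64)) (Var nNP)
            (Seq (Set nA (Div (Num 1) (Mul (Num 128) (Add (Var nNF) (Num 1))))) (Set nB (Num 0)))
            (Seq (Set nA (Num 0)) (Set nB (Div (Var nD) (Var nQ)))))
         (Set nD (Num 0))"

definition update_arc :: com where
  "update_arc =
     Seq (Assign nX iV (Mul (Cell nX iV) (Sub (Num 1) (Mul (Var nA) (Cell nDF iV)))))
    (Seq (Assign nS iV (Sub (Cell nS iV) (Mul (Var nB) voltage_drop)))
         (Set nD (Add (Var nD) (Mul (Cell nX iV) (Cell nS iV)))))"

definition update_node :: com where
  "update_node = Assign nY iV (Add (Cell nY iV) (Mul (Var nB) (Cell 1 (Add mV iV))))"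

definition output_arc :: com where
  "output_arc = Seq (Assign 1 iV (Cell nX iV)) (Assign 1 (Add (Add mV nV) iV) (Cell nS iV))"

definition output_node :: com where
  "output_node = Assign 1 (Add mV iV) (Cell nY iV)"

definition initialise :: com where
  "initialise =
     Seq read_sizes (Seq (For nI nM read_arc) (Seq (For nI nN read_node)
    (Seq (Set nQ (Num 0)) (Seq root_loop (Seq (Set nQ (Add mV (Var nQ))) set_flag)))))"

definition update :: com where
  "update =
     Seq clear_norms (Seq (For nI nM directions)
    (Seq step_sizes (Seq (For nI nM update_arc) (Seq (For nI nN update_node) set_flag))))"

definition iteration :: "com \<Rightarrow> com" where
  "iteration E = Seq (Seq write_sizes (For nI nM write_arc)) (Seq E update)"

definition write_output :: com where
  "write_output = Seq (For nI nM output_arc) (For nI nN output_node)"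

definition main_loop :: "com \<Rightarrow> com" where
  "main_loop E = WhileLess (Num 0) (Var nF) (iteration E)"

definition potential_reduction_algorithm :: "com \<Rightarrow> com" where
  "potential_reduction_algorithm E = Seq initialise (Seq (main_loop E) write_output)"

definition holds_graph :: "nat \<Rightarrow> nat \<Rightarrow> (nat \<Rightarrow> nat) \<Rightarrow> (nat \<Rightarrow> nat) \<Rightarrow> store \<Rightarrow> bool" where
  "holds_graph n m h t \<sigma> \<longleftrightarrow> \<sigma> nN 0 = of_nat n \<and> \<sigma> nM 0 = of_nat m \<and>
     (\<forall>a<m. \<sigma> nT a = of_nat (t a) \<and> \<sigma> nH a = of_nat (h a)) \<and>
     \<sigma> nQ 0 = of_nat (potential_parameter m)"

definition holds_point ::
    "nat \<Rightarrow> nat \<Rightarrow> (nat \<Rightarrow> rat) \<Rightarrow> (nat \<Rightarrow> rat) \<Rightarrow> (nat \<Rightarrow> rat) \<Rightarrow> store \<Rightarrow> bool" where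
  "holds_point n m x y s \<sigma> \<longleftrightarrow>
     (\<forall>a<m. \<sigma> nX a = x a \<and> \<sigma> nS a = s a) \<and> (\<forall>v<n. \<sigma> nY v = y v) \<and> \<sigma> nD 0 = gap m x s"

definition holds_flag :: "store \<Rightarrow> bool" where
  "holds_flag \<sigma> \<longleftrightarrow> \<sigma> nF 0 = (if \<sigma> nD 0 < 1 then 0 else 1)"

section \<open>Correctness and cost of the single loops\<close>

lemma runs_directions:
  assumes g: "holds_graph n m h t \<sigma>" and x: "\<And>a. a < m \<Longrightarrow> \<sigma> nX a = x a" "\<And>a. a < m \<Longrightarrow> x a > 0"
    and G: "\<And>a. a < m \<Longrightarrow> \<sigma> nG a = scaled_gradient q m x s a"
    and f: "\<And>a. a < m \<Longrightarrow> \<sigma> 1 a = f a" and \<pi>: "\<And>v. v < n \<Longrightarrow> \<sigma> 1 (m + v) = \<pi> v"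
    and h: "\<And>a. a < m \<Longrightarrow> h a < n" and t: "\<And>a. a < m \<Longrightarrow> t a < n"
    and z: "\<sigma> nNF 0 = 0" "\<sigma> nNP 0 = 0"
  defines "d \<equiv> flow_direction q m x s f" and "d' \<equiv> voltage_direction h t q m x s \<pi>"
  shows "\<exists>\<sigma>'. runs (for_cost directions * (m + 1)) (For nI nM directions) \<sigma> \<sigma>' \<and>
    ((\<forall>a<m. \<sigma>' nDF a = d a) \<and> \<sigma>' nNF 0 = sq_sum d m \<and> \<sigma>' nNP 0 = sq_sum d' m) \<and>
    (\<forall>a. a \<noteq> nI \<longrightarrow> a \<notin> written_names directions \<longrightarrow> \<sigma>' a = \<sigma> a)"
proof (rule runs_For[where Inv = "\<lambda>k \<tau>. (\<forall>a<k. \<tau> nDF a = d a) \<and> \<tau> nNF 0 = sq_sum d k \<and> \<tau> nNP 0 = sq_sum d' k"], goal_cases)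
  case (7 k \<tau>)
  have fr: "\<tau> nN = \<sigma> nN" "\<tau> nM = \<sigma> nM" "\<tau> nT = \<sigma> nT" "\<tau> nH = \<sigma> nH" "\<tau> nX = \<sigma> nX" "\<tau> nG = \<sigma> nG" "\<tau> 1 = \<sigma> 1"
    by (rule 7(4); simp add: directions_def)+
  from 7 g h[of k] t[of k] x[of k] show ?case
    by (auto simp: directions_def fr holds_graph_def f \<pi> G less_Suc_eq sq_sum_def d_def d'_def
       flow_direction_def voltage_direction_def)
qed (use g z in \<open>auto simp: holds_graph_def directions_def sq_sum_def\<close>)

lemma runs_read_arc:
  assumes nm: "\<sigma> nN 0 = of_nat n" "\<sigma> nM 0 = of_nat m"
    and i: "\<And>a. a < m \<Longrightarrow> \<sigma> 0 (2 + a) = of_nat (t a)" "\<And>a. a < m \<Longrightarrow> \<sigma> 0 (2 + m + a) = of_nat (h a)"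
      "\<And>a. a < m \<Longrightarrow> \<sigma> 0 (2 + 3 * m + n + a) = x a" "\<And>a. a < m \<Longrightarrow> \<sigma> 0 (2 + 4 * m + 2 * n + a) = s a"
    and z: "\<sigma> nD 0 = 0"
  shows "\<exists>\<sigma>'. runs (for_cost read_arc * (m + 1)) (For nI nM read_arc) \<sigma> \<sigma>' \<and>
    ((\<forall>a<m. \<sigma>' nT a = of_nat (t a) \<and> \<sigma>' nH a = of_nat (h a) \<and> \<sigma>' nX a = x a \<and> \<sigma>' nS a = s a) \<and>
      \<sigma>' nD 0 = gap m x s) \<and>
    (\<forall>a. a \<noteq> nI \<longrightarrow> a \<notin> written_names read_arc \<longrightarrow> \<sigma>' a = \<sigma> a)"
proof (rule runs_For[where Inv = "\<lambda>k \<tau>. (\<forall>a<k. \<tau> nT a = of_nat (t a) \<and> \<tau> nH a = of_nat (h a) \<and>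
    \<tau> nX a = x a \<and> \<tau> nS a = s a) \<and> \<tau> nD 0 = gap k x s"], goal_cases)
  case (7 k \<tau>)
  have fr: "\<tau> nN = \<sigma> nN" "\<tau> nM = \<sigma> nM" "\<tau> 0 = \<sigma> 0" by (rule 7(4); simp add: read_arc_def)+
  from 7 show ?case by (auto simp: read_arc_def fr nm i less_Suc_eq gap_def)
qed (use nm z in \<open>auto simp: read_arc_def gap_def\<close>)

lemma runs_read_node:
  assumes nm: "\<sigma> nN 0 = of_nat n" "\<sigma> nM 0 = of_nat m"
    and i: "\<And>v. v < n \<Longrightarrow> \<sigma> 0 (2 + 4 * m + n + v) = y v"
  shows "\<exists>\<sigma>'. runs (for_cost read_node * (n + 1)) (For nI nN read_node) \<sigma> \<sigma>' \<and>
    (\<forall>v<n. \<sigma>' nY v = y v) \<and> (\<forall>a. a \<noteq> nI \<longrightarrow> a \<notin> written_names read_node \<longrightarrow> \<sigma>' a = \<sigma> a)"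
proof (rule runs_For[where Inv = "\<lambda>k \<tau>. \<forall>v<k. \<tau> nY v = y v"], goal_cases)
  case (7 k \<tau>)
  have fr: "\<tau> nN = \<sigma> nN" "\<tau> nM = \<sigma> nM" "\<tau> 0 = \<sigma> 0" by (rule 7(4); simp add: read_node_def)+
  from 7 show ?case by (auto simp: read_node_def fr nm i less_Suc_eq)
qed (use nm in \<open>auto simp: read_node_def\<close>)

text \<open>The number of rounds is not stored in a cell beforehand, so this loop needs its own
  induction, on the distance to the least root; minimality makes every earlier test succeed.\<close>

lemma runs_root_loop:
  assumes "\<sigma> nM 0 = of_nat m" "\<sigma> nQ 0 = 0"
  shows "\<exists>\<sigma>'. runs (18 * (m + 1)) root_loop \<sigma> \<sigma>' \<and> \<sigma>' nQ 0 = of_nat (LEAST k. k\<^sup>2 \<ge> m)"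
proof -
  define r where "r = (LEAST k. k\<^sup>2 \<ge> m)"
  have m2: "m \<le> m\<^sup>2" by (simp add: power2_eq_square)
  have r: "m \<le> r\<^sup>2" unfolding r_def using m2 by (rule LeastI)
  have rm: "r \<le> m" unfolding r_def using m2 by (rule Least_le)
  have lt: "k\<^sup>2 < m" if "k < r" for k using not_less_Least[of k] that by (force simp: r_def)
  have "\<exists>\<sigma>'. runs (18 * (r - k) + 10) root_loop \<sigma> \<sigma>' \<and> \<sigma>' nQ 0 = of_nat r"
    if "k \<le> r" "\<sigma> nM 0 = of_nat m" "\<sigma> nQ 0 = of_nat k" for k \<sigma>
    using that
  proof (induction "r - k" arbitrary: k \<sigma>)
    case 0
    then have [simp]: "k = r" by simp
    have e: "eval (Mul (Var nQ) (Var nQ)) \<sigma> = Some (of_nat (r\<^sup>2))" "eval mV \<sigma> = Some (of_nat m)"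
      using 0 by (auto simp: power2_eq_square)
    have "exec root_loop \<sigma> (1 + cost (Mul (Var nQ) (Var nQ)) + cost mV) \<sigma>"
      unfolding root_loop_def using r by (intro exec.WhileFalse[OF e]) simp
    then have "runs (18 * (r - k) + 10) root_loop \<sigma> \<sigma>" by (rule runs_mono[OF runs_exec]) simp
    with 0 show ?case by auto
  next
    case (Suc j)
    then have k: "k < r" by simp
    define \<sigma>2 where "\<sigma>2 = \<sigma>(nQ := (\<sigma> nQ)(0 := of_nat (Suc k)))"
    have e: "eval (Mul (Var nQ) (Var nQ)) \<sigma> = Some (of_nat (k\<^sup>2))" "eval mV \<sigma> = Some (of_nat m)"
      using Suc by (auto simp: power2_eq_square)
    have "exec (Set nQ (Add (Var nQ) (Num 1))) \<sigma> (1 + cost (Num 0) + cost (Add (Var nQ) (Num 1))) \<sigma>2"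
      unfolding \<sigma>2_def using Suc by (intro exec.Assign) auto
    moreover obtain \<sigma>' where \<sigma>': "runs (18 * (r - Suc k) + 10) root_loop \<sigma>2 \<sigma>'" "\<sigma>' nQ 0 = of_nat r"
      using Suc(1)[of "Suc k" \<sigma>2] Suc(2,4) k by (force simp: \<sigma>2_def)
    then obtain t2 where t2: "t2 \<le> 18 * (r - Suc k) + 10" "exec root_loop \<sigma>2 t2 \<sigma>'" by (auto simp: runs_def)
    moreover have "of_nat (k\<^sup>2) < (of_nat m :: rat)" using lt[OF k] by (simp only: of_nat_less_iff)
    ultimately have "exec root_loop \<sigma> (1 + cost (Mul (Var nQ) (Var nQ)) + cost mV
        + (1 + cost (Num 0) + cost (Add (Var nQ) (Num 1))) + t2) \<sigma>'"
      unfolding root_loop_def by (intro exec.WhileTrue[OF e])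
    then have "runs (18 * (r - k) + 10) root_loop \<sigma> \<sigma>'"
      by (rule runs_mono[OF runs_exec]) (use t2(1) k in simp)
    with \<sigma>' show ?case by blast
  qed
  from this[of 0 \<sigma>] assms obtain \<sigma>' where "runs (18 * r + 10) root_loop \<sigma> \<sigma>'" "\<sigma>' nQ 0 = of_nat r" by auto
  moreover from this(1) have "runs (18 * (m + 1)) root_loop \<sigma> \<sigma>'" by (rule runs_mono) (use rm in simp)
  ultimately show ?thesis unfolding r_def[symmetric] by blast
qed

lemma runs_write_arc:
  assumes g: "holds_graph n m h t \<sigma>" and q: "q = potential_parameter m"
    and x: "\<And>a. a < m \<Longrightarrow> \<sigma> nX a = x a" "\<And>a. a < m \<Longrightarrow> x a > 0"
    and s: "\<And>a. a < m \<Longrightarrow> \<sigma> nS a = s a" and D: "\<sigma> nD 0 = gap m x s" "gap m x s > 0"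
    and h: "\<And>a. a < m \<Longrightarrow> h a < n" and t: "\<And>a. a < m \<Longrightarrow> t a < n"
    and z: "\<sigma> 0 0 = of_nat n" "\<sigma> 0 1 = of_nat m" "\<And>v. v < n \<Longrightarrow> \<sigma> 0 (2 + 3 * m + v) = 0"
      "\<sigma> 0 (2 + 3 * m + n) = \<epsilon>" "\<And>i. 2 + 3 * m + n < i \<Longrightarrow> \<sigma> 0 i = 0"
  defines "gr \<equiv> scaled_gradient q m x s"
  shows "\<exists>\<sigma>'. runs (for_cost write_arc * (m + 1)) (For nI nM write_arc) \<sigma> \<sigma>' \<and>
    ((\<forall>a<m. \<sigma>' nG a = gr a \<and> \<sigma>' 0 (2 + a) = of_nat (t a) \<and> \<sigma>' 0 (2 + m + a) = of_nat (h a) \<and>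
       \<sigma>' 0 (2 + 2 * m + a) = 1 / (x a * x a)) \<and>
     (\<forall>v<n. \<sigma>' 0 (2 + 3 * m + v) = net_inflow h t (\<lambda>a. x a * gr a) m v) \<and>
     \<sigma>' 0 0 = of_nat n \<and> \<sigma>' 0 1 = of_nat m \<and> \<sigma>' 0 (2 + 3 * m + n) = \<epsilon> \<and>
     (\<forall>i. 2 + 3 * m + n < i \<longrightarrow> \<sigma>' 0 i = 0)) \<and>
    (\<forall>a. a \<noteq> nI \<longrightarrow> a \<notin> written_names write_arc \<longrightarrow> \<sigma>' a = \<sigma> a)"
proof (rule runs_For[where Inv = "\<lambda>k \<tau>.
    (\<forall>a<k. \<tau> nG a = gr a \<and> \<tau> 0 (2 + a) = of_nat (t a) \<and> \<tau> 0 (2 + m + a) = of_nat (h a) \<and>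
       \<tau> 0 (2 + 2 * m + a) = 1 / (x a * x a)) \<and>
     (\<forall>v<n. \<tau> 0 (2 + 3 * m + v) = net_inflow h t (\<lambda>a. x a * gr a) k v) \<and>
     \<tau> 0 0 = of_nat n \<and> \<tau> 0 1 = of_nat m \<and> \<tau> 0 (2 + 3 * m + n) = \<epsilon> \<and>
     (\<forall>i. 2 + 3 * m + n < i \<longrightarrow> \<tau> 0 i = 0)"], goal_cases)
  case (7 k \<tau>)
  have fr: "\<tau> nN = \<sigma> nN" "\<tau> nM = \<sigma> nM" "\<tau> nT = \<sigma> nT" "\<tau> nH = \<sigma> nH" "\<tau> nX = \<sigma> nX" "\<tau> nS = \<sigma> nS"
    "\<tau> nQ = \<sigma> nQ" "\<tau> nD = \<sigma> nD"
    by (rule 7(4); simp add: write_arc_def)+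
  define w where "w = x k * gr k"
  have st: "\<sigma> nN 0 = of_nat n" "\<sigma> nM 0 = of_nat m" "\<sigma> nT k = of_nat (t k)" "\<sigma> nH k = of_nat (h k)"
    "\<sigma> nQ 0 = of_nat q" using g 7(1) by (auto simp: holds_graph_def q)
  have grk: "gr k = of_nat q * (x k * s k) / gap m x s - 1" by (simp add: gr_def scaled_gradient_def)
  have ni: "net_inflow h t (\<lambda>a. x a * gr a) (Suc k) v =
      net_inflow h t (\<lambda>a. x a * gr a) k v + ((if h k = v then w else 0) - (if t k = v then w else 0))" for v
    by (simp add: net_inflow_def incidence_def w_def)
  \<comment> \<open>The two changes of the currents are kept in sequence, the second reading the
    result of the first, because head and tail of an arc may coincide.\<close>
  define A where "A = (\<tau> 0)(2 + k := of_nat (t k), 2 + m + k := of_nat (h k), 2 + 2 * m + k := 1 / (x k * x k))"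
  define B where "B = A(2 + 3 * m + h k := A (2 + 3 * m + h k) + w)"
  define C where "C = B(2 + 3 * m + t k := B (2 + 3 * m + t k) + (0 - w))"
  have sem: "sem write_arc \<tau> = Some (\<tau>(nG := (\<tau> nG)(k := gr k), nW := (\<tau> nW)(0 := w), 0 := C))"
    unfolding C_def B_def A_def w_def grk
    using 7(1,3) x[of k] s[of k] D by (auto simp: write_arc_def fr st fun_eq_iff)
  have "h k < n" "t k < n" using h t 7(1) by auto
  then show ?case using 7(1,2) unfolding sem ni C_def B_def A_def
    by (auto simp: less_Suc_eq)
next
  case 5
  then show ?case using z by (auto simp: net_inflow_def)
qed (use g in \<open>auto simp: write_arc_def holds_graph_def\<close>)

text \<open>The point is overwritten in place, so the invariant also records that the entries not
  yet visited still have their old values.\<close>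

lemma runs_update_arc:
  assumes g: "holds_graph n m h t \<sigma>" and h: "\<And>a. a < m \<Longrightarrow> h a < n" and t: "\<And>a. a < m \<Longrightarrow> t a < n"
    and x: "\<And>a. a < m \<Longrightarrow> \<sigma> nX a = x a" and s: "\<And>a. a < m \<Longrightarrow> \<sigma> nS a = s a"
    and d: "\<And>a. a < m \<Longrightarrow> \<sigma> nDF a = d a" and \<pi>: "\<And>v. v < n \<Longrightarrow> \<sigma> 1 (m + v) = \<pi> v"
    and st: "\<sigma> nA 0 = \<alpha>" "\<sigma> nB 0 = \<beta>" "\<sigma> nD 0 = 0"
    and x': "\<And>a. x' a = x a * (1 - \<alpha> * d a)" and s': "\<And>a. s' a = s a - \<beta> * (\<pi> (h a) - \<pi> (t a))"
  shows "\<exists>\<sigma>'. runs (for_cost update_arc * (m + 1)) (For nI nM update_arc) \<sigma> \<sigma>' \<and>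
    ((\<forall>a<m. \<sigma>' nX a = x' a \<and> \<sigma>' nS a = s' a) \<and>
      (\<forall>a\<ge>m. \<sigma>' nX a = \<sigma> nX a \<and> \<sigma>' nS a = \<sigma> nS a) \<and> \<sigma>' nD 0 = gap m x' s') \<and>
    (\<forall>a. a \<noteq> nI \<longrightarrow> a \<notin> written_names update_arc \<longrightarrow> \<sigma>' a = \<sigma> a)"
proof (rule runs_For[where Inv = "\<lambda>k \<tau>. (\<forall>a<k. \<tau> nX a = x' a \<and> \<tau> nS a = s' a) \<and>
    (\<forall>a\<ge>k. \<tau> nX a = \<sigma> nX a \<and> \<tau> nS a = \<sigma> nS a) \<and> \<tau> nD 0 = gap k x' s'"], goal_cases)
  case (7 k \<tau>)
  have fr: "\<tau> nN = \<sigma> nN" "\<tau> nM = \<sigma> nM" "\<tau> nT = \<sigma> nT" "\<tau> nH = \<sigma> nH" "\<tau> nA = \<sigma> nA" "\<tau> nB = \<sigma> nB"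
    "\<tau> nDF = \<sigma> nDF" "\<tau> 1 = \<sigma> 1"
    by (rule 7(4); simp add: update_arc_def)+
  from 7 g h[of k] t[of k] show ?case
    by (auto simp: update_arc_def fr holds_graph_def st d x s \<pi> x' s' gap_def less_Suc_eq)
qed (use g st in \<open>auto simp: holds_graph_def update_arc_def gap_def\<close>)

lemma runs_update_node:
  assumes g: "holds_graph n m h t \<sigma>" and y: "\<And>v. v < n \<Longrightarrow> \<sigma> nY v = y v"
    and \<pi>: "\<And>v. v < n \<Longrightarrow> \<sigma> 1 (m + v) = \<pi> v" and \<beta>: "\<sigma> nB 0 = \<beta>"
  shows "\<exists>\<sigma>'. runs (for_cost update_node * (n + 1)) (For nI nN update_node) \<sigma> \<sigma>' \<and>
    ((\<forall>v<n. \<sigma>' nY v = y v + \<beta> * \<pi> v) \<and> (\<forall>v\<ge>n. \<sigma>' nY v = \<sigma> nY v)) \<and>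
    (\<forall>a. a \<noteq> nI \<longrightarrow> a \<notin> written_names update_node \<longrightarrow> \<sigma>' a = \<sigma> a)"
proof (rule runs_For[where Inv = "\<lambda>k \<tau>. (\<forall>v<k. \<tau> nY v = y v + \<beta> * \<pi> v) \<and>
    (\<forall>v\<ge>k. \<tau> nY v = \<sigma> nY v)"], goal_cases)
  case (7 k \<tau>)
  have fr: "\<tau> nN = \<sigma> nN" "\<tau> nM = \<sigma> nM" "\<tau> nB = \<sigma> nB" "\<tau> 1 = \<sigma> 1"
    by (rule 7(4); simp add: update_node_def)+
  from 7 g show ?case by (auto simp: update_node_def fr holds_graph_def \<beta> \<pi> y less_Suc_eq)
qed (use g in \<open>auto simp: holds_graph_def update_node_def\<close>)

lemma runs_output_arc:
  assumes g: "holds_graph n m h t \<sigma>" and p: "holds_point n m x y s \<sigma>"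
  shows "\<exists>\<sigma>'. runs (for_cost output_arc * (m + 1)) (For nI nM output_arc) \<sigma> \<sigma>' \<and>
    (\<forall>a<m. \<sigma>' 1 a = x a \<and> \<sigma>' 1 (m + n + a) = s a) \<and>
    (\<forall>a. a \<noteq> nI \<longrightarrow> a \<notin> written_names output_arc \<longrightarrow> \<sigma>' a = \<sigma> a)"
proof (rule runs_For[where Inv = "\<lambda>k \<tau>. \<forall>a<k. \<tau> 1 a = x a \<and> \<tau> 1 (m + n + a) = s a"], goal_cases)
  case (7 k \<tau>)
  have fr: "\<tau> nN = \<sigma> nN" "\<tau> nM = \<sigma> nM" "\<tau> nX = \<sigma> nX" "\<tau> nS = \<sigma> nS"
    by (rule 7(4); simp add: output_arc_def)+
  from 7 g p show ?case by (auto simp: output_arc_def fr holds_graph_def holds_point_def less_Suc_eq)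
qed (use g in \<open>auto simp: holds_graph_def output_arc_def\<close>)

lemma runs_output_node:
  assumes g: "holds_graph n m h t \<sigma>" and p: "holds_point n m x y s \<sigma>"
    and o: "\<forall>a<m. \<sigma> 1 a = x a \<and> \<sigma> 1 (m + n + a) = s a"
  shows "\<exists>\<sigma>'. runs (for_cost output_node * (n + 1)) (For nI nN output_node) \<sigma> \<sigma>' \<and>
    ((\<forall>a<m. \<sigma>' 1 a = x a \<and> \<sigma>' 1 (m + n + a) = s a) \<and> (\<forall>v<n. \<sigma>' 1 (m + v) = y v)) \<and>
    (\<forall>a. a \<noteq> nI \<longrightarrow> a \<notin> written_names output_node \<longrightarrow> \<sigma>' a = \<sigma> a)"
proof (rule runs_For[where Inv = "\<lambda>k \<tau>. (\<forall>a<m. \<tau> 1 a = x a \<and> \<tau> 1 (m + n + a) = s a) \<and>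
    (\<forall>v<k. \<tau> 1 (m + v) = y v)"], goal_cases)
  case (7 k \<tau>)
  have fr: "\<tau> nN = \<sigma> nN" "\<tau> nM = \<sigma> nM" "\<tau> nY = \<sigma> nY"
    by (rule 7(4); simp add: output_node_def)+
  from 7 g p show ?case by (auto simp: output_node_def fr holds_graph_def holds_point_def less_Suc_eq)
qed (use g o in \<open>auto simp: holds_graph_def output_node_def\<close>)

lemma runs_set_flag:
  "\<exists>\<sigma>'. runs (max_cost set_flag) set_flag \<sigma> \<sigma>' \<and> holds_flag \<sigma>' \<and> (\<forall>a. a \<noteq> nF \<longrightarrow> \<sigma>' a = \<sigma> a)"
proof -
  obtain \<sigma>' where "sem set_flag \<sigma> = Some \<sigma>'" "holds_flag \<sigma>'" "\<forall>a. a \<noteq> nF \<longrightarrow> \<sigma>' a = \<sigma> a"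
    by (cases "\<sigma> nD 0 < 1") (auto simp: set_flag_def holds_flag_def)
  then show ?thesis using runs_straight by blast
qed

definition init_cost :: nat where
  "init_cost = max_cost read_sizes + for_cost read_arc + for_cost read_node + max_cost (Set nQ (Num 0)) + 18
     + max_cost (Set nQ (Add mV (Var nQ))) + max_cost set_flag"

lemma runs_initialise:
  assumes nm: "\<sigma> 0 0 = of_nat n" "\<sigma> 0 1 = of_nat m"
    and i: "\<And>a. a < m \<Longrightarrow> \<sigma> 0 (2 + a) = of_nat (t a)" "\<And>a. a < m \<Longrightarrow> \<sigma> 0 (2 + m + a) = of_nat (h a)"
      "\<And>a. a < m \<Longrightarrow> \<sigma> 0 (2 + 3 * m + n + a) = x a" "\<And>a. a < m \<Longrightarrow> \<sigma> 0 (2 + 4 * m + 2 * n + a) = s a"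
      "\<And>v. v < n \<Longrightarrow> \<sigma> 0 (2 + 4 * m + n + v) = y v"
    and L: "L = n + m + 1"
  shows "\<exists>\<sigma>'. runs (init_cost * L) initialise \<sigma> \<sigma>' \<and>
    holds_graph n m h t \<sigma>' \<and> holds_point n m x y s \<sigma>' \<and> holds_flag \<sigma>'"
proof -
  obtain \<sigma>1 where s1: "sem read_sizes \<sigma> = Some \<sigma>1" and 1: "\<sigma>1 nN 0 = of_nat n" "\<sigma>1 nM 0 = of_nat m"
    "\<sigma>1 nD 0 = 0" "\<sigma>1 0 = \<sigma> 0"
    using nm by (auto simp: read_sizes_def)
  note r1 = runs_straight[OF s1]
  obtain \<sigma>2 where r2: "runs (for_cost read_arc * (m + 1)) (For nI nM read_arc) \<sigma>1 \<sigma>2"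
    and 2: "\<forall>a<m. \<sigma>2 nT a = of_nat (t a) \<and> \<sigma>2 nH a = of_nat (h a) \<and> \<sigma>2 nX a = x a \<and> \<sigma>2 nS a = s a"
      "\<sigma>2 nD 0 = gap m x s"
    and f2: "\<And>a. a \<noteq> nI \<Longrightarrow> a \<notin> written_names read_arc \<Longrightarrow> \<sigma>2 a = \<sigma>1 a"
    using runs_read_arc[of \<sigma>1 n m t h x s] 1 i by auto
  have b2: "\<sigma>2 nN 0 = of_nat n" "\<sigma>2 nM 0 = of_nat m" "\<sigma>2 0 = \<sigma> 0"
    using f2[of nN] f2[of nM] f2[of 0] 1 by (simp_all add: read_arc_def)
  obtain \<sigma>3 where r3: "runs (for_cost read_node * (n + 1)) (For nI nN read_node) \<sigma>2 \<sigma>3"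
    and 3: "\<forall>v<n. \<sigma>3 nY v = y v" and f3: "\<And>a. a \<noteq> nI \<Longrightarrow> a \<notin> written_names read_node \<Longrightarrow> \<sigma>3 a = \<sigma>2 a"
    using runs_read_node[of \<sigma>2 n m y] b2 i by auto
  obtain \<sigma>4 where s4: "sem (Set nQ (Num 0)) \<sigma>3 = Some \<sigma>4" and 4: "\<sigma>4 nQ 0 = 0" "\<And>a. a \<noteq> nQ \<Longrightarrow> \<sigma>4 a = \<sigma>3 a"
    by auto
  note r4 = runs_straight[OF s4]
  have b4: "\<sigma>4 nM 0 = of_nat m" using 4(2)[of nM] f3[of nM] b2 by (simp add: read_node_def)
  obtain \<sigma>5 where r5: "runs (18 * (m + 1)) root_loop \<sigma>4 \<sigma>5" and 5: "\<sigma>5 nQ 0 = of_nat (LEAST k. k\<^sup>2 \<ge> m)"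
    using runs_root_loop[of \<sigma>4 m] b4 4 by auto
  have f5: "\<And>a. a \<noteq> nQ \<Longrightarrow> \<sigma>5 a = \<sigma>4 a" using runs_frame[OF r5] by (simp add: root_loop_def)
  have b5: "\<sigma>5 nM 0 = of_nat m" using f5[of nM] b4 by simp
  obtain \<sigma>6 where s6: "sem (Set nQ (Add mV (Var nQ))) \<sigma>5 = Some \<sigma>6"
    and 6: "\<sigma>6 nQ 0 = of_nat (potential_parameter m)" and f6: "\<And>a. a \<noteq> nQ \<Longrightarrow> \<sigma>6 a = \<sigma>5 a"
    using 5 b5 by (auto simp: potential_parameter_def)
  note r6 = runs_straight[OF s6]
  obtain \<sigma>7 where r7: "runs (max_cost set_flag) set_flag \<sigma>6 \<sigma>7" and 7: "holds_flag \<sigma>7"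
    and f7: "\<And>a. a \<noteq> nF \<Longrightarrow> \<sigma>7 a = \<sigma>6 a"
    using runs_set_flag[of \<sigma>6] by auto
  have fr: "\<sigma>7 a = \<sigma>3 a" if "a \<noteq> nF" "a \<noteq> nQ" for a using that 4(2) f5 f6 f7 by simp
  have fr2: "\<sigma>7 a = \<sigma>2 a" if "a \<noteq> nF" "a \<noteq> nQ" "a \<noteq> nI" "a \<noteq> nY" for a
    using that fr f3 by (simp add: read_node_def)
  have "runs (init_cost * L) initialise \<sigma> \<sigma>7"
    unfolding initialise_def
    by (rule runs_mono[OF runs_Seq[OF r1 runs_Seq[OF r2 runs_Seq[OF r3 runs_Seq[OF r4 runs_Seq[OF r5 runs_Seq[OF r6 r7]]]]]]])
      (simp add: init_cost_def L algebra_simps)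
  moreover have "holds_graph n m h t \<sigma>7" "holds_point n m x y s \<sigma>7"
    unfolding holds_graph_def holds_point_def
    using fr2[of nN] fr2[of nM] fr2[of nT] fr2[of nH] fr2[of nX] fr2[of nS] fr2[of nD] fr[of nY] f7[of nQ] 6 2 b2 3
    by auto
  ultimately show ?thesis using 7 by blast
qed

definition update_cost :: nat where
  "update_cost = max_cost clear_norms + for_cost directions + max_cost step_sizes + for_cost update_arc
     + for_cost update_node + max_cost set_flag"

lemma runs_update:
  assumes g: "holds_graph n m h t \<sigma>" and p: "holds_point n m x y s \<sigma>" and x0: "\<And>a. a < m \<Longrightarrow> x a > 0"
    and q: "q = potential_parameter m" "q > 0"
    and G: "\<And>a. a < m \<Longrightarrow> \<sigma> nG a = scaled_gradient q m x s a"
    and f: "\<And>a. a < m \<Longrightarrow> \<sigma> 1 a = f a" and \<pi>: "\<And>v. v < n \<Longrightarrow> \<sigma> 1 (m + v) = \<pi> v"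
    and h: "\<And>a. a < m \<Longrightarrow> h a < n" and t: "\<And>a. a < m \<Longrightarrow> t a < n" and L: "L = n + m + 1"
    and d: "d = flow_direction q m x s f"
    and NP: "NP = sq_sum (voltage_direction h t q m x s \<pi>) m" and NF: "NF = sq_sum d m"
    and x': "\<And>a. x' a = x a * (1 - primal_step NP NF * d a)"
    and s': "\<And>a. s' a = s a - dual_step NP (gap m x s / of_nat q) * (\<pi> (h a) - \<pi> (t a))"
    and y': "\<And>v. y' v = y v + dual_step NP (gap m x s / of_nat q) * \<pi> v"
  shows "\<exists>\<sigma>'. runs (update_cost * L) update \<sigma> \<sigma>' \<and>
    holds_graph n m h t \<sigma>' \<and> holds_point n m x' y' s' \<sigma>' \<and> holds_flag \<sigma>'"
proof -
  have graph_cong: "holds_graph n m h t \<tau>'"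
    if "holds_graph n m h t \<tau>" "\<And>a. a \<in> {nN, nM, nT, nH, nQ} \<Longrightarrow> \<tau>' a = \<tau> a" for \<tau> \<tau>'
    using that by (simp add: holds_graph_def)
  obtain \<sigma>1 where s1: "sem clear_norms \<sigma> = Some \<sigma>1" and 1: "\<sigma>1 nNF 0 = 0" "\<sigma>1 nNP 0 = 0"
    and f1: "\<And>a. a \<noteq> nNF \<Longrightarrow> a \<noteq> nNP \<Longrightarrow> \<sigma>1 a = \<sigma> a"
    by (auto simp: clear_norms_def)
  note r1 = runs_straight[OF s1]
  have g1: "holds_graph n m h t \<sigma>1" by (rule graph_cong[OF g]) (auto simp: f1)
  obtain \<sigma>2 where r2: "runs (for_cost directions * (m + 1)) (For nI nM directions) \<sigma>1 \<sigma>2"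
    and 2: "\<forall>a<m. \<sigma>2 nDF a = d a" "\<sigma>2 nNF 0 = NF" "\<sigma>2 nNP 0 = NP"
    and f2: "\<And>a. a \<noteq> nI \<Longrightarrow> a \<notin> written_names directions \<Longrightarrow> \<sigma>2 a = \<sigma>1 a"
    using runs_directions[of n m h t \<sigma>1 x q s f \<pi>] g1 1 f1[of nX] f1[of nG] f1[of 1] p x0 G f \<pi> h t
    unfolding NF NP d holds_point_def by auto
  have f2': "\<sigma>2 a = \<sigma> a" if "a \<notin> {nI, nDF, nNF, nW, nNP}" for a
    using that f1 f2 by (simp add: directions_def)
  have NF0: "NF \<ge> 0" unfolding NF sq_sum_def by (intro sum_nonneg) auto
  have b2: "\<sigma>2 nD 0 = gap m x s" "\<sigma>2 nQ 0 = of_nat q"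
    using f2'[of nD] f2'[of nQ] p g by (simp_all add: holds_point_def holds_graph_def q)
  \<comment> \<open>Division by zero has no value and would block the run.\<close>
  have "NF + 1 \<noteq> 0" using NF0 by simp
  then obtain \<sigma>3 where s3: "sem step_sizes \<sigma>2 = Some \<sigma>3" and 3: "\<sigma>3 nA 0 = primal_step NP NF"
      "\<sigma>3 nB 0 = dual_step NP (gap m x s / of_nat q)" "\<sigma>3 nD 0 = 0"
    and f3: "\<And>a. a \<noteq> nA \<Longrightarrow> a \<noteq> nB \<Longrightarrow> a \<noteq> nD \<Longrightarrow> \<sigma>3 a = \<sigma>2 a"
    using 2 b2 q(2) by (cases "9 / 64 < NP") (auto simp: step_sizes_def primal_step_def dual_step_def)
  note r3 = runs_straight[OF s3]
  have g3: "holds_graph n m h t \<sigma>3" by (rule graph_cong[OF g]) (auto simp: f3 f2')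
  have 31: "\<sigma>3 1 = \<sigma> 1" "\<sigma>3 nX = \<sigma> nX" "\<sigma>3 nS = \<sigma> nS" "\<sigma>3 nY = \<sigma> nY" "\<sigma>3 nDF = \<sigma>2 nDF"
    by (simp_all add: f3 f2')
  obtain \<sigma>4 where r4: "runs (for_cost update_arc * (m + 1)) (For nI nM update_arc) \<sigma>3 \<sigma>4"
    and 4: "\<forall>a<m. \<sigma>4 nX a = x' a \<and> \<sigma>4 nS a = s' a" "\<sigma>4 nD 0 = gap m x' s'"
    and f4: "\<And>a. a \<noteq> nI \<Longrightarrow> a \<notin> written_names update_arc \<Longrightarrow> \<sigma>4 a = \<sigma>3 a"
    using runs_update_arc[where x = x and s = s and d = d and \<pi> = \<pi> and x' = x' and s' = s', OF g3 h t _ _ _ _ 3 x' s']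
      p 2 \<pi> unfolding 31 holds_point_def by auto
  have f4': "\<sigma>4 a = \<sigma>3 a" if "a \<notin> {nI, nX, nS, nD}" for a
    using that f4 by (simp add: update_arc_def)
  have g4: "holds_graph n m h t \<sigma>4" by (rule graph_cong[OF g3]) (auto simp: f4')
  have 41: "\<sigma>4 1 = \<sigma> 1" "\<sigma>4 nY = \<sigma> nY" "\<sigma>4 nB 0 = dual_step NP (gap m x s / of_nat q)"
    using 31 3 by (simp_all add: f4')
  obtain \<sigma>5 where r5: "runs (for_cost update_node * (n + 1)) (For nI nN update_node) \<sigma>4 \<sigma>5"
    and 5: "\<forall>v<n. \<sigma>5 nY v = y' v"
    and f5: "\<And>a. a \<noteq> nI \<Longrightarrow> a \<notin> written_names update_node \<Longrightarrow> \<sigma>5 a = \<sigma>4 a"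
    using runs_update_node[OF g4 _ _ 41(3), of y \<pi>] p \<pi> unfolding 41 holds_point_def y' by auto
  have f5': "\<sigma>5 a = \<sigma>4 a" if "a \<notin> {nI, nY}" for a
    using that f5 by (simp add: update_node_def)
  obtain \<sigma>6 where r6: "runs (max_cost set_flag) set_flag \<sigma>5 \<sigma>6" and 6: "holds_flag \<sigma>6"
    and f6: "\<And>a. a \<noteq> nF \<Longrightarrow> \<sigma>6 a = \<sigma>5 a"
    using runs_set_flag[of \<sigma>5] by auto
  have "runs (update_cost * L) update \<sigma> \<sigma>6"
    unfolding update_def
    by (rule runs_mono[OF runs_Seq[OF r1 runs_Seq[OF r2 runs_Seq[OF r3 runs_Seq[OF r4 runs_Seq[OF r5 r6]]]]]])
      (simp add: update_cost_def L algebra_simps)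
  moreover have "holds_graph n m h t \<sigma>6" by (rule graph_cong[OF g4]) (auto simp: f6 f5')
  moreover have "holds_point n m x' y' s' \<sigma>6"
    using 4 5 by (simp add: holds_point_def f6 f5')
  ultimately show ?thesis using 6 by blast
qed

section \<open>Calling the subroutine and completing an iteration\<close>

definition call_cost :: nat where
  "call_cost = max_cost write_sizes + for_cost write_arc"

text \<open>The memory has to equal \<open>initial_store ins\<close> on every array that the
  subroutine may name and at every index, including those beyond the input, since the subroutine may
  read anywhere.\<close>

lemma runs_call:
  assumes G: "numbered_digraph n m G" and g: "holds_graph n m h t \<sigma>" and ht: "h = head G" "t = tail G"
    and p: "holds_point n m x y s \<sigma>"
    and x0: "\<And>a. a < m \<Longrightarrow> x a > 0" and gap: "gap m x s > 0"
    and q: "q = potential_parameter m" "q > 0" and L: "L = n + m + 1"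
    and ins: "ins = encode_digraph n m G @ map (\<lambda>a. 1 / (x a * x a)) [0..<m]
         @ map (net_inflow h t (\<lambda>a. x a * scaled_gradient q m x s a) m) [0..<n] @ [1 / (16 * (of_nat q)\<^sup>2)]"
  shows "\<exists>\<sigma>'. runs (call_cost * L) (Seq write_sizes (For nI nM write_arc)) \<sigma> \<sigma>' \<and>
    holds_graph n m h t \<sigma>' \<and> holds_point n m x y s \<sigma>' \<and>
    (\<forall>a<m. \<sigma>' nG a = scaled_gradient q m x s a) \<and> (\<forall>a<K + 4. \<sigma>' a = initial_store ins a)"
proof -
  have h: "h a < n" and t: "t a < n" if "a < m" for a
    using numbered_digraph_bounds[OF G that] by (simp_all add: ht)
  define \<epsilon> :: rat where "\<epsilon> = 1 / (16 * (of_nat q)\<^sup>2)"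
  define A where "A = (\<lambda>_. 0 :: rat)(0 := of_nat n, 1 := of_nat m, 2 + 3 * m + n := \<epsilon>)"
  define \<sigma>1 where "\<sigma>1 = (\<lambda>a. if a < K + 4 then (\<lambda>_. 0) else \<sigma> a)(0 := A)"
  have s1: "sem write_sizes \<sigma> = Some \<sigma>1"
    using g q by (auto simp: write_sizes_def sem_clear_below holds_graph_def \<sigma>1_def A_def \<epsilon>_def
        power2_eq_square fun_eq_iff)
  note r1 = runs_straight[OF s1]
  have f1: "\<sigma>1 a = \<sigma> a" if "a \<ge> K + 4" for a using that by (simp add: \<sigma>1_def)
  have g1: "holds_graph n m h t \<sigma>1" using g by (simp add: holds_graph_def f1)
  have p1: "holds_point n m x y s \<sigma>1" using p by (simp add: holds_point_def f1)
  obtain \<sigma>2 where r2: "runs (for_cost write_arc * (m + 1)) (For nI nM write_arc) \<sigma>1 \<sigma>2"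
    and 2: "\<forall>a<m. \<sigma>2 nG a = scaled_gradient q m x s a \<and> \<sigma>2 0 (2 + a) = of_nat (t a) \<and>
       \<sigma>2 0 (2 + m + a) = of_nat (h a) \<and> \<sigma>2 0 (2 + 2 * m + a) = 1 / (x a * x a)"
     "\<forall>v<n. \<sigma>2 0 (2 + 3 * m + v) = net_inflow h t (\<lambda>a. x a * scaled_gradient q m x s a) m v"
     "\<sigma>2 0 0 = of_nat n" "\<sigma>2 0 1 = of_nat m" "\<sigma>2 0 (2 + 3 * m + n) = \<epsilon>"
     "\<forall>i. 2 + 3 * m + n < i \<longrightarrow> \<sigma>2 0 i = 0"
    and f2: "\<And>a. a \<noteq> nI \<Longrightarrow> a \<notin> written_names write_arc \<Longrightarrow> \<sigma>2 a = \<sigma>1 a"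
    using runs_write_arc[where x = x and s = s and \<epsilon> = \<epsilon>, OF g1 q(1) _ x0 _ _ gap h t] p1
    by (auto simp: holds_point_def \<sigma>1_def A_def)
  have f2': "\<sigma>2 a = \<sigma>1 a" if "a \<notin> {nI, nG, nW, 0}" for a
    using that f2 by (simp add: write_arc_def)
  have "runs (call_cost * L) (Seq write_sizes (For nI nM write_arc)) \<sigma> \<sigma>2"
    by (rule runs_mono[OF runs_Seq[OF r1 r2]]) (simp add: call_cost_def L algebra_simps)
  moreover have "holds_graph n m h t \<sigma>2" using g1 by (simp add: holds_graph_def f2')
  moreover have "holds_point n m x y s \<sigma>2" using p1 by (simp add: holds_point_def f2')
  moreover have "\<sigma>2 0 i = initial_store ins 0 i" for i
  proof -
    have len: "length ins = 2 + 3 * m + n + 1" by (simp add: ins encode_digraph_def)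
    consider "i = 0" | "i = 1" | a where "a < m" "i = 2 + a" | a where "a < m" "i = 2 + m + a"
      | a where "a < m" "i = 2 + 2 * m + a" | v where "v < n" "i = 2 + 3 * m + v" | "i = 2 + 3 * m + n"
      | "2 + 3 * m + n < i"
    proof -
      have "i = 0 \<or> i = 1 \<or> (\<exists>a<m. i = 2 + a) \<or> (\<exists>a<m. i = 2 + m + a) \<or> (\<exists>a<m. i = 2 + 2 * m + a) \<or>
          (\<exists>v<n. i = 2 + 3 * m + v) \<or> i = 2 + 3 * m + n \<or> 2 + 3 * m + n < i"
        by presburger
      then show thesis using that by blast
    qed
    then show ?thesis
    proof cases
      case 8
      then show ?thesis using 2 len by (simp add: initial_store_def)
    qed (use 2 len in \<open>auto simp: initial_store_def ins encode_digraph_def nth_append ht \<epsilon>_def nth_Cons'\<close>)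
  qed
  then have "\<sigma>2 a = initial_store ins a" if "a < K + 4" for a
    using that f2'[of a] by (cases "a = 0") (auto simp: \<sigma>1_def initial_store_def)
  ultimately show ?thesis using 2(1) by blast
qed

definition feasible ::
    "nat \<Rightarrow> nat \<Rightarrow> (nat \<Rightarrow> nat) \<Rightarrow> (nat \<Rightarrow> nat) \<Rightarrow> (nat \<Rightarrow> rat) \<Rightarrow> (nat \<Rightarrow> rat) \<Rightarrow>
     (nat \<Rightarrow> rat) \<Rightarrow> (nat \<Rightarrow> rat) \<Rightarrow> (nat \<Rightarrow> rat) \<Rightarrow> bool" where
  "feasible n m h t b c x y s \<longleftrightarrow>
     (\<forall>a<m. x a > 0 \<and> s a > 0 \<and> y (h a) - y (t a) + s a = c a) \<and> (\<forall>v<n. net_inflow h t x m v = b v)"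

text \<open>The last two conclusions serve the accounting: \<open>B\<close> is an integer time bound
  below \<open>CEF\<close>, and n + m + 1 \<le> B lets all work linear in the graph be charged to
  the call.\<close>

lemma runs_iteration:
  assumes E: "certifying_electrical_flow_algorithm E CEF" and names: "com_names E \<subseteq> {..<K + 4}"
    and G: "numbered_digraph n m G" and m: "m \<ge> 1" and ht: "h = head G" "t = tail G"
    and q: "q = potential_parameter m"
    and F: "feasible n m h t b c x y s"
    and g: "holds_graph n m h t \<sigma>" and p: "holds_point n m x y s \<sigma>"
    and B: "B = nat \<lfloor>CEF n m (1 / (16 * (of_nat q)\<^sup>2))\<rfloor>"
  shows "\<exists>x' y' s' \<sigma>'. runs ((1 + call_cost + update_cost) * B) (iteration E) \<sigma> \<sigma>' \<and>
    holds_graph n m h t \<sigma>' \<and> holds_point n m x' y' s' \<sigma>' \<and> holds_flag \<sigma>' \<and>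
    feasible n m h t b c x' y' s' \<and>
    pot q m (of_rat_fun x') (of_rat_fun s') \<le> pot q m (of_rat_fun x) (of_rat_fun s) - 1 / 32768"
    and "n + m + 1 \<le> B" and "real B \<le> CEF n m (1 / (16 * (of_nat q)\<^sup>2))"
proof -
  have h: "h a < n" and t: "t a < n" if "a < m" for a
    using numbered_digraph_bounds[OF G that] by (simp_all add: ht)
  have x0: "x a > 0" and s0: "s a > 0" if "a < m" for a using F that by (auto simp: feasible_def)
  have q0: "q > 0" using m by (simp add: q potential_parameter_def)
  have gap0: "gap m x s > 0" unfolding gap_def using m x0 s0 by (intro sum_pos) (auto simp: lessThan_empty_iff)
  define L where "L = n + m + 1"
  define ins where "ins = encode_digraph n m G @ map (\<lambda>a. 1 / (x a * x a)) [0..<m]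
         @ map (net_inflow h t (\<lambda>a. x a * scaled_gradient q m x s a) m) [0..<n] @ [1 / (16 * (of_nat q)\<^sup>2)]"
  obtain f \<pi> T where T: "computes_in_time E ins (map f [0..<m] @ map \<pi> [0..<n]) T"
    and TC: "real T \<le> CEF n m (1 / (16 * (of_nat q)\<^sup>2))"
    and flow: "\<And>v. v < n \<Longrightarrow> net_inflow h t f m v = net_inflow h t (\<lambda>a. x a * scaled_gradient q m x s a) m v"
    and desc: "9 / 64 < sq_sum (voltage_direction h t q m x s \<pi>) m \<Longrightarrow>
      (\<Sum>a<m. of_rat_fun (scaled_gradient q m x s) a * of_rat_fun (flow_direction q m x s f) a) \<ge>
      real_of_rat (sq_sum (flow_direction q m x s f) m) / 2 + 1 / 128"
    unfolding ins_def ht q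
    by (rule electrical_algorithm_step[OF E G m x0 s0]) blast+
  obtain k \<sigma>e where e: "exec E (initial_store ins) k \<sigma>e"
    and outs: "map f [0..<m] @ map \<pi> [0..<n] = map (\<sigma>e 1) [0..<m + n]"
    and Tk: "T = k + length ins + (m + n)"
    using T by (auto simp: computes_in_time_def)
  \<comment> \<open>The time of the call counts at least one input number and all m + n output
    numbers, which already makes n + m + 1.\<close>
  have "length ins \<ge> 1" by (simp add: ins_def)
  then have LT: "k \<le> T" "L \<le> T" using Tk by (simp_all add: L_def)
  have TB: "T \<le> B" unfolding B using TC by (simp add: le_nat_floor)
  show LB: "n + m + 1 \<le> B" using LT TB by (simp add: L_def)
  show "real B \<le> CEF n m (1 / (16 * (of_nat q)\<^sup>2))"
    unfolding B using order_trans[OF of_nat_0_le_iff TC] by simp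
  have out1: "\<sigma>e 1 a = f a" if "a < m" for a
    using arg_cong[OF outs, of "\<lambda>l. l ! a"] that by (simp add: nth_append)
  have out2: "\<sigma>e 1 (m + v) = \<pi> v" if "v < n" for v
    using arg_cong[OF outs, of "\<lambda>l. l ! (m + v)"] that by (simp add: nth_append)
  obtain \<sigma>1 where r1: "runs (call_cost * L) (Seq write_sizes (For nI nM write_arc)) \<sigma> \<sigma>1"
    and 1: "holds_graph n m h t \<sigma>1" "holds_point n m x y s \<sigma>1"
      "\<forall>a<m. \<sigma>1 nG a = scaled_gradient q m x s a" and ini: "\<forall>a<K + 4. \<sigma>1 a = initial_store ins a"
    using runs_call[OF G g ht p x0 gap0 q q0 L_def ins_def] by blast
  \<comment> \<open>The specified run starts from a memory without the caller's arrays. Agreement on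
    the names of \<open>E\<close> carries it over, and the arrays from K + 4 on survive because
    \<open>E\<close> cannot write them.\<close>
  have "\<forall>a\<in>{..<K + 4}. initial_store ins a = \<sigma>1 a" using ini by simp
  from exec_agree[OF e names this] obtain \<sigma>2 where e2: "exec E \<sigma>1 k \<sigma>2"
    and a2: "\<forall>a\<in>{..<K + 4}. \<sigma>e a = \<sigma>2 a" by blast
  have f2: "\<sigma>2 a = \<sigma>1 a" if "a \<ge> K + 4" for a
    using exec_frame[OF e2, of a] written_names_subset[of E] names that by force
  have 21: "\<sigma>2 1 = \<sigma>e 1" using a2 by simp
  have g2: "holds_graph n m h t \<sigma>2" using 1 by (simp add: holds_graph_def f2)
  have p2: "holds_point n m x y s \<sigma>2" using 1 by (simp add: holds_point_def f2)
  define d where "d = flow_direction q m x s f"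
  define NP where "NP = sq_sum (voltage_direction h t q m x s \<pi>) m"
  define NF where "NF = sq_sum d m"
  define x' where "x' a = x a * (1 - primal_step NP NF * d a)" for a
  define s' where "s' a = s a - dual_step NP (gap m x s / of_nat q) * (\<pi> (h a) - \<pi> (t a))" for a
  define y' where "y' v = y v + dual_step NP (gap m x s / of_nat q) * \<pi> v" for v
  obtain \<sigma>3 where r3: "runs (update_cost * L) update \<sigma>2 \<sigma>3"
    and 3: "holds_graph n m h t \<sigma>3" "holds_point n m x' y' s' \<sigma>3" "holds_flag \<sigma>3"
    using runs_update[OF g2 p2 x0 q q0 _ _ _ h t L_def d_def NP_def NF_def x'_def s'_def y'_def]
      1(3) out1 out2 by (auto simp: f2 21)
  have "runs ((1 + call_cost + update_cost) * B) (iteration E) \<sigma> \<sigma>3"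
    unfolding iteration_def
  proof (rule runs_mono[OF runs_Seq[OF r1 runs_Seq[OF runs_exec[OF e2] r3]]])
    have "call_cost * L \<le> call_cost * B" "update_cost * L \<le> update_cost * B" "k \<le> B"
      using LT TB by simp_all
    then show "call_cost * L + (k + update_cost * L) \<le> (1 + call_cost + update_cost) * B"
      unfolding distrib_right mult_1 by linarith
  qed
  moreover note red = potential_reduction[where n = n, OF m x0 s0 q flow d_def NP_def NF_def desc[folded d_def NP_def, folded NF_def] x'_def s'_def]
  have "feasible n m h t b c x' y' s'"
    unfolding feasible_def
  proof (intro conjI allI impI)
    fix a assume a: "a < m"
    then show "x' a > 0" "s' a > 0" using red(1,2) by auto
    show "y' (h a) - y' (t a) + s' a = c a"
      using F a by (simp add: feasible_def y'_def s'_def algebra_simps)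
  next
    fix v assume v: "v < n"
    have "net_inflow h t x' m v = net_inflow h t x m v" by (rule red(3)) (use v in auto)
    then show "net_inflow h t x' m v = b v" using F v by (simp add: feasible_def)
  qed
  ultimately show "\<exists>x' y' s' \<sigma>'. runs ((1 + call_cost + update_cost) * B) (iteration E) \<sigma> \<sigma>' \<and>
    holds_graph n m h t \<sigma>' \<and> holds_point n m x' y' s' \<sigma>' \<and> holds_flag \<sigma>' \<and>
    feasible n m h t b c x' y' s' \<and>
    pot q m (of_rat_fun x') (of_rat_fun s') \<le> pot q m (of_rat_fun x) (of_rat_fun s) - 1 / 32768"
    using 3 red(4) by blast
qed

section \<open>The potential bounds the number of iterations\<close>

text \<open>Induction on \<open>j\<close>, the potential measured in units of the guaranteed
  decrease. The bound is strict so that j = 0 means a negative potential, which is incompatible with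
  a gap of at least 1; the loop has then stopped.\<close>

lemma runs_main_loop:
  assumes E: "certifying_electrical_flow_algorithm E CEF" and names: "com_names E \<subseteq> {..<K + 4}"
    and G: "numbered_digraph n m G" and m: "m \<ge> 1" and ht: "h = head G" "t = tail G"
    and q: "q = potential_parameter m"
    and B: "B = nat \<lfloor>CEF n m (1 / (16 * (of_nat q)\<^sup>2))\<rfloor>"
    and "feasible n m h t b c x y s" "holds_graph n m h t \<sigma>" "holds_point n m x y s \<sigma>" "holds_flag \<sigma>"
    and "pot q m (of_rat_fun x) (of_rat_fun s) < real j / 32768"
  shows "\<exists>x' y' s' \<sigma>'. runs (j * (4 + (1 + call_cost + update_cost) * B) + 4) (main_loop E) \<sigma> \<sigma>' \<and>
    holds_graph n m h t \<sigma>' \<and> holds_point n m x' y' s' \<sigma>' \<and>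
    feasible n m h t b c x' y' s' \<and> gap m x' s' < 1"
proof -
  have stop: "runs 4 (main_loop E) \<sigma> \<sigma>"
    if "holds_point n m x y s \<sigma>" "holds_flag \<sigma>" "gap m x s < 1" for x y s \<sigma>
  proof -
    have e: "eval (Num 0) \<sigma> = Some 0" "eval (Var nF) \<sigma> = Some 0"
      using that by (auto simp: holds_flag_def holds_point_def)
    have "exec (main_loop E) \<sigma> (1 + cost (Num 0) + cost (Var nF)) \<sigma>"
      unfolding main_loop_def by (rule exec.WhileFalse[OF e]) simp
    then show ?thesis by (rule runs_mono[OF runs_exec]) simp
  qed
  show ?thesis using assms(9-)
  proof (induction j arbitrary: x y s \<sigma>)
    case (0 x y s \<sigma>)
    show ?case
    proof (cases "gap m x s < 1")
      case True
      then have "runs (0 * (4 + (1 + call_cost + update_cost) * B) + 4) (main_loop E) \<sigma> \<sigma>"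
        using stop[OF 0(3,4)] by simp
      then show ?thesis using 0 True by blast
    next
      case False
      obtain k where k: "q = m + k" using potential_parameter_split[of m] by (auto simp: q)
      have "real_of_rat 1 \<le> real_of_rat (gap m x s)" using False by (simp only: of_rat_less_eq not_less)
      then have "real k * ln (\<Sum>a<m. of_rat_fun x a * of_rat_fun s a) \<ge> 0"
        by (simp add: gap_def of_rat_sum_fun of_rat_mult)
      moreover have "pot (m + k) m (of_rat_fun x) (of_rat_fun s) \<ge> real k * ln (\<Sum>a<m. of_rat_fun x a * of_rat_fun s a)"
        using 0(1) m by (intro pot_ge) (auto simp: feasible_def)
      ultimately show ?thesis using 0(5) by (simp add: k)
    qed
  next
    case (Suc j x y s \<sigma>)
    show ?case
    proof (cases "gap m x s < 1")
      case True
      have "runs (Suc j * (4 + (1 + call_cost + update_cost) * B) + 4) (main_loop E) \<sigma> \<sigma>"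
        by (rule runs_mono[OF stop[OF Suc.prems(3,4) True]]) simp
      then show ?thesis using Suc.prems True by blast
    next
      case False
      then have e: "eval (Num 0) \<sigma> = Some 0" "eval (Var nF) \<sigma> = Some 1"
        using Suc.prems by (auto simp: holds_flag_def holds_point_def)
      obtain x1 y1 s1 \<sigma>1 where r1: "runs ((1 + call_cost + update_cost) * B) (iteration E) \<sigma> \<sigma>1"
        and 1: "holds_graph n m h t \<sigma>1" "holds_point n m x1 y1 s1 \<sigma>1" "holds_flag \<sigma>1"
          "feasible n m h t b c x1 y1 s1"
        and pot: "pot q m (of_rat_fun x1) (of_rat_fun s1) \<le> pot q m (of_rat_fun x) (of_rat_fun s) - 1 / 32768"
        using runs_iteration(1)[OF E names G m ht q Suc.prems(1,2,3) B] by blast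
      have "pot q m (of_rat_fun x1) (of_rat_fun s1) < real j / 32768"
        using pot Suc.prems(5) by (simp add: add_divide_distrib)
      from Suc.IH[OF 1(4,1,2,3) this] obtain x' y' s' \<sigma>'
        where r2: "runs (j * (4 + (1 + call_cost + update_cost) * B) + 4) (main_loop E) \<sigma>1 \<sigma>'"
        and 2: "holds_graph n m h t \<sigma>'" "holds_point n m x' y' s' \<sigma>'" "feasible n m h t b c x' y' s'" "gap m x' s' < 1"
        by blast
      from r1 r2 obtain t1 t2 where t1: "t1 \<le> (1 + call_cost + update_cost) * B" "exec (iteration E) \<sigma> t1 \<sigma>1"
        and t2: "t2 \<le> j * (4 + (1 + call_cost + update_cost) * B) + 4" "exec (main_loop E) \<sigma>1 t2 \<sigma>'"
        by (auto simp: runs_def)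
      have "exec (main_loop E) \<sigma> (1 + cost (Num 0) + cost (Var nF) + t1 + t2) \<sigma>'"
        unfolding main_loop_def by (rule exec.WhileTrue[OF e _ t1(2) t2(2)[unfolded main_loop_def]]) simp
      then have "runs (Suc j * (4 + (1 + call_cost + update_cost) * B) + 4) (main_loop E) \<sigma> \<sigma>'"
        by (rule runs_mono[OF runs_exec]) (use t1(1) t2(1) in simp)
      then show ?thesis using 2 by blast
    qed
  qed
qed

definition output_cost :: nat where
  "output_cost = for_cost output_arc + for_cost output_node"

lemma runs_write_output:
  assumes g: "holds_graph n m h t \<sigma>" and p: "holds_point n m x y s \<sigma>" and L: "L = n + m + 1"
  shows "\<exists>\<sigma>'. runs (output_cost * L) write_output \<sigma> \<sigma>' \<and>
    (\<forall>a<m. \<sigma>' 1 a = x a \<and> \<sigma>' 1 (m + n + a) = s a) \<and> (\<forall>v<n. \<sigma>' 1 (m + v) = y v)"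
proof -
  obtain \<sigma>1 where r1: "runs (for_cost output_arc * (m + 1)) (For nI nM output_arc) \<sigma> \<sigma>1"
    and 1: "\<forall>a<m. \<sigma>1 1 a = x a \<and> \<sigma>1 1 (m + n + a) = s a"
    and f1: "\<And>a. a \<noteq> nI \<Longrightarrow> a \<notin> written_names output_arc \<Longrightarrow> \<sigma>1 a = \<sigma> a"
    using runs_output_arc[OF g p] by auto
  have "holds_graph n m h t \<sigma>1" "holds_point n m x y s \<sigma>1"
    using g p by (simp_all add: holds_graph_def holds_point_def f1 output_arc_def)
  from runs_output_node[OF this 1] obtain \<sigma>2
    where r2: "runs (for_cost output_node * (n + 1)) (For nI nN output_node) \<sigma>1 \<sigma>2"
    and 2: "\<forall>a<m. \<sigma>2 1 a = x a \<and> \<sigma>2 1 (m + n + a) = s a" "\<forall>v<n. \<sigma>2 1 (m + v) = y v"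
    by auto
  have "runs (output_cost * L) write_output \<sigma> \<sigma>2"
    unfolding write_output_def
    by (rule runs_mono[OF runs_Seq[OF r1 r2]]) (simp add: output_cost_def L algebra_simps)
  with 2 show ?thesis by blast
qed

end

section \<open>Back to vectors, and the total running time\<close>

lemma list_of_vec_eq_map: "v \<in> carrier_vec n \<Longrightarrow> list_of_vec v = map (($) v) [0..<n]"
  by (auto simp: list_eq_iff_nth_eq list_of_vec_index)

lemma potential_eq_pot:
  assumes "x \<in> carrier_vec m" "s \<in> carrier_vec m"
  shows "potential m (real_vec x) (real_vec s) =
    pot (potential_parameter m) m (of_rat_fun (($) x)) (of_rat_fun (($) s))"
  using assms by (simp add: potential_def pot_def scalar_prod_def atLeast0LessThan)

lemma feasible_of_interior:
  assumes G: "numbered_digraph n m G" and P: "interior_primal (incidence_mat n m G) b x"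
    and D: "interior_dual (incidence_mat n m G) c y s"
  shows "feasible n m (head G) (tail G) (($) b) (($) c) (($) x) (($) y) (($) s)"
proof -
  have x: "x \<in> carrier_vec m" "incidence_mat n m G *\<^sub>v x = b" "\<forall>a<m. x $ a > 0"
    using P unfolding interior_primal_def incidence_mat_dims by auto
  have y: "y \<in> carrier_vec n" "s \<in> carrier_vec m" "(incidence_mat n m G)\<^sup>T *\<^sub>v y + s = c" "\<forall>a<m. s $ a > 0"
    using D unfolding interior_dual_def incidence_mat_dims by auto
  have "y $ (head G a) - y $ (tail G a) + s $ a = c $ a" if "a < m" for a
    using incidence_mat_transpose_mult_vec[OF G y(1) that] y(2,3) that by auto
  moreover have "net_inflow (head G) (tail G) (($) x) m v = b $ v" if "v < n" for v
    using incidence_mat_mult_vec[OF x(1) that, of G] x(2) by simp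
  ultimately show ?thesis using x y by (simp add: feasible_def)
qed

lemma interior_of_feasible:
  assumes G: "numbered_digraph n m G" and b: "b \<in> carrier_vec n" and c: "c \<in> carrier_vec m"
    and F: "feasible n m (head G) (tail G) (($) b) (($) c) x y s"
  shows "interior_primal (incidence_mat n m G) b (vec m x)"
    and "interior_dual (incidence_mat n m G) c (vec n y) (vec m s)"
proof -
  have "incidence_mat n m G *\<^sub>v vec m x = b"
  proof (rule eq_vecI)
    fix v assume "v < dim_vec b"
    then have v: "v < n" using b by simp
    have "net_inflow (head G) (tail G) (($) (vec m x)) m v = net_inflow (head G) (tail G) x m v"
      unfolding net_inflow_def by (intro sum.cong) auto
    then show "(incidence_mat n m G *\<^sub>v vec m x) $ v = b $ v"
      using F v incidence_mat_mult_vec[of "vec m x" m v n G] by (simp add: feasible_def)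
  qed (use b incidence_mat_dims in auto)
  then show "interior_primal (incidence_mat n m G) b (vec m x)"
    unfolding interior_primal_def incidence_mat_dims using F by (auto simp: feasible_def)
  have "(incidence_mat n m G)\<^sup>T *\<^sub>v vec n y + vec m s = c"
  proof (rule eq_vecI)
    fix a assume "a < dim_vec c"
    then have a: "a < m" using c by simp
    then show "((incidence_mat n m G)\<^sup>T *\<^sub>v vec n y + vec m s) $ a = c $ a"
      using F numbered_digraph_bounds[OF G a] incidence_mat_transpose_mult_vec[OF G vec_carrier a, of y]
      by (simp add: feasible_def)
  qed (use c incidence_mat_dims in auto)
  then show "interior_dual (incidence_mat n m G) c (vec n y) (vec m s)"
    unfolding interior_dual_def incidence_mat_dims using F by (auto simp: feasible_def)
qed

lemma potential_reduction_algorithm_correct: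
  assumes E: "certifying_electrical_flow_algorithm E CEF" and names: "com_names E \<subseteq> {..<K + 4}"
    and G: "numbered_digraph n m G" and m: "m \<ge> 1"
    and P: "interior_primal (incidence_mat n m G) b x"
    and D: "interior_dual (incidence_mat n m G) c y s"
    and P0: "P\<^sub>0 = potential m (real_vec x) (real_vec s)"
    and C: "C = 32769 * (5 + call_cost K + update_cost K) + init_cost K + output_cost K + 11"
  shows "\<exists>x' y' s' t.
         computes_in_time (potential_reduction_algorithm K E)
           (encode_digraph n m G @ list_of_vec b @ list_of_vec c
              @ list_of_vec x @ list_of_vec y @ list_of_vec s)
           (list_of_vec x' @ list_of_vec y' @ list_of_vec s') t \<and>
         interior_primal (incidence_mat n m G) b x' \<and>
         interior_dual (incidence_mat n m G) c y' s' \<and>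
         x' \<bullet> s' < 1 \<and>
         real t \<le> real C * (max 1 P\<^sub>0 * CEF n m (1 / (16 * (of_nat (potential_parameter m))\<^sup>2)))"
proof -
  define q where "q = potential_parameter m"
  define h where "h = head G"
  define t where "t = tail G"
  define B where "B = nat \<lfloor>CEF n m (1 / (16 * (of_nat q)\<^sup>2))\<rfloor>"
  define L where "L = n + m + 1"
  have xc: "x \<in> carrier_vec m" using P unfolding interior_primal_def incidence_mat_dims by auto
  have yc: "y \<in> carrier_vec n" and sc: "s \<in> carrier_vec m" using D unfolding interior_dual_def incidence_mat_dims by auto
  have bc: "b \<in> carrier_vec n" using P xc by (auto simp: interior_primal_def intro!: mult_mat_vec_carrier[of _ n m])
  have cc: "c \<in> carrier_vec m"
  proof -
    have "(incidence_mat n m G)\<^sup>T *\<^sub>v y \<in> carrier_vec m" using yc by (intro mult_mat_vec_carrier[of _ m n]) auto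
    then show ?thesis using D sc by (auto simp: interior_dual_def)
  qed
  define ins where "ins = encode_digraph n m G @ list_of_vec b @ list_of_vec c
              @ list_of_vec x @ list_of_vec y @ list_of_vec s"
  have lens: "length ins = 2 + 5 * m + 2 * n"
    using xc yc sc bc cc by (simp add: ins_def encode_digraph_def)
  have ins_map: "ins = [of_nat n, of_nat m] @ map (\<lambda>a. of_nat (t a)) [0..<m] @ map (\<lambda>a. of_nat (h a)) [0..<m]
      @ map (($) b) [0..<n] @ map (($) c) [0..<m] @ map (($) x) [0..<m] @ map (($) y) [0..<n] @ map (($) s) [0..<m]"
    unfolding ins_def encode_digraph_def h_def t_def list_of_vec_eq_map[OF xc] list_of_vec_eq_map[OF yc]
      list_of_vec_eq_map[OF sc] list_of_vec_eq_map[OF bc] list_of_vec_eq_map[OF cc] by simp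
  define \<sigma> where "\<sigma> = initial_store ins"
  have \<sigma>: "\<sigma> 0 i = ins ! i" if "i < 2 + 5 * m + 2 * n" for i
    using that lens by (simp add: \<sigma>_def initial_store_def)
  have F: "feasible n m h t (($) b) (($) c) (($) x) (($) y) (($) s)"
    unfolding h_def t_def by (rule feasible_of_interior[OF G P D])
  obtain \<sigma>1 where r1: "runs (init_cost K * L) (initialise K) \<sigma> \<sigma>1"
    and 1: "holds_graph K n m h t \<sigma>1" "holds_point K n m (($) x) (($) y) (($) s) \<sigma>1" "holds_flag K \<sigma>1"
  proof -
    have "\<exists>\<sigma>'. runs (init_cost K * L) (initialise K) \<sigma> \<sigma>' \<and>
      holds_graph K n m h t \<sigma>' \<and> holds_point K n m (($) x) (($) y) (($) s) \<sigma>' \<and> holds_flag K \<sigma>'"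
      by (rule runs_initialise[OF _ _ _ _ _ _ _ L_def]; subst \<sigma>)
        (auto simp: ins_map nth_append nth_Cons')
    then show thesis using that by blast
  qed
  \<comment> \<open>Adding 1 to the floor makes the bound on the potential strict; as the maximum is
    at least 1, this only raises the factor from 32768 to 32769.\<close>
  define j where "j = nat \<lfloor>32768 * max 1 P\<^sub>0\<rfloor> + 1"
  have P0': "P\<^sub>0 = pot q m (of_rat_fun (($) x)) (of_rat_fun (($) s))"
    unfolding P0 q_def by (rule potential_eq_pot[OF xc sc])
  have "32768 * P\<^sub>0 \<le> 32768 * max 1 P\<^sub>0" by simp
  also have "\<dots> < real j" unfolding j_def by linarith
  finally have "pot q m (of_rat_fun (($) x)) (of_rat_fun (($) s)) < real j / 32768" unfolding P0' by simp
  from runs_main_loop[OF E names G m h_def t_def q_def B_def F 1 this] obtain x' y' s' \<sigma>2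
    where r2: "runs (j * (4 + (1 + call_cost K + update_cost K) * B) + 4) (main_loop K E) \<sigma>1 \<sigma>2"
    and 2: "holds_graph K n m h t \<sigma>2" "holds_point K n m x' y' s' \<sigma>2"
    and F': "feasible n m h t (($) b) (($) c) x' y' s'" and gap: "gap m x' s' < 1" by blast
  obtain \<sigma>3 where r3: "runs (output_cost K * L) (write_output K) \<sigma>2 \<sigma>3"
    and 3: "\<forall>a<m. \<sigma>3 1 a = x' a \<and> \<sigma>3 1 (m + n + a) = s' a" "\<forall>v<n. \<sigma>3 1 (m + v) = y' v"
    using runs_write_output[OF 2 L_def] by blast
  define T where "T = init_cost K * L + ((j * (4 + (1 + call_cost K + update_cost K) * B) + 4) + output_cost K * L)"
  have "runs T (potential_reduction_algorithm K E) \<sigma> \<sigma>3"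
    unfolding potential_reduction_algorithm_def T_def by (rule runs_Seq[OF r1 runs_Seq[OF r2 r3]])
  then obtain k where k: "k \<le> T" "exec (potential_reduction_algorithm K E) \<sigma> k \<sigma>3" by (auto simp: runs_def)
  define outs where "outs = list_of_vec (vec m x') @ list_of_vec (vec n y') @ list_of_vec (vec m s')"
  have outs: "outs = map x' [0..<m] @ map y' [0..<n] @ map s' [0..<m]"
    by (simp add: outs_def list_of_vec_eq_map[OF vec_carrier])
  have "outs = map (\<sigma>3 1) [0..<length outs]"
  proof (rule nth_equalityI)
    fix i assume "i < length outs"
    then have "i < m \<or> (\<exists>v<n. i = m + v) \<or> (\<exists>a<m. i = m + n + a)"
      unfolding outs by simp presburger
    then show "outs ! i = map (\<sigma>3 1) [0..<length outs] ! i"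
      using 3 by (auto simp: outs nth_append)
  qed simp
  then have comp: "computes_in_time (potential_reduction_algorithm K E) ins outs (k + length ins + length outs)"
    unfolding computes_in_time_def using k(2) \<sigma>_def by blast
  have it: "n + m + 1 \<le> B" "real B \<le> CEF n m (1 / (16 * (of_nat q)\<^sup>2))"
    using runs_iteration(2,3)[OF E names G m h_def t_def q_def F 1(1,2) B_def] by auto
  have time: "real (k + length ins + length outs) \<le> real C * (max 1 P\<^sub>0 * CEF n m (1 / (16 * (of_nat q)\<^sup>2)))"
  proof -
    \<comment> \<open>Per iteration: 4 units for the loop test and at most \<open>B\<close> for the
      run of \<open>E\<close>, both absorbed in 5 B.\<close>
    define A where "A = 5 + call_cost K + update_cost K"
    have LB: "L \<le> B" using it(1) by (simp add: L_def)
    have B1: "1 \<le> B" using it(1) by simp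
    have "4 + (1 + call_cost K + update_cost K) * B \<le> A * B" using B1 by (simp add: A_def distrib_right)
    then have "j * (4 + (1 + call_cost K + update_cost K) * B) \<le> j * (A * B)" by simp
    moreover have "init_cost K * L \<le> init_cost K * B" "output_cost K * L \<le> output_cost K * B"
      using LB by simp_all
    \<comment> \<open>Altogether 2 + 7 m + 3 n numbers are loaded and unloaded. With the 4 units of
      the last loop test this explains the summand 11.\<close>
    moreover have "length ins + length outs \<le> 7 * L" by (simp add: lens outs L_def)
    ultimately have "k + length ins + length outs \<le>
        j * (A * B) + init_cost K * B + output_cost K * B + 11 * B"
      using k(1) LB B1 unfolding T_def by linarith
    then have "real (k + length ins + length outs) \<le>
        real (j * (A * B) + init_cost K * B + output_cost K * B + 11 * B)" by (simp only: of_nat_le_iff)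
    also have "\<dots> = real j * (real A * real B) + real (init_cost K + output_cost K + 11) * real B"
      by (simp add: algebra_simps)
    also have "\<dots> \<le> (32769 * max 1 P\<^sub>0) * (real A * real B) + (real (init_cost K + output_cost K + 11) * max 1 P\<^sub>0) * real B"
    proof (intro add_mono mult_right_mono)
      show "real j \<le> 32769 * max 1 P\<^sub>0" unfolding j_def by linarith
      show "real (init_cost K + output_cost K + 11) \<le> real (init_cost K + output_cost K + 11) * max 1 P\<^sub>0"
        using mult_left_mono[of 1 "max 1 P\<^sub>0" "real (init_cost K + output_cost K + 11)"] by simp
    qed auto
    also have "\<dots> = real C * (max 1 P\<^sub>0 * real B)" unfolding C A_def by (simp add: algebra_simps)
    also have "\<dots> \<le> real C * (max 1 P\<^sub>0 * CEF n m (1 / (16 * (of_nat q)\<^sup>2)))"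
      using it(2) by (intro mult_left_mono) auto
    finally show ?thesis .
  qed
  have "vec m x' \<bullet> vec m s' < 1" using gap by (simp add: gap_def scalar_prod_def atLeast0LessThan)
  with comp time interior_of_feasible[OF G bc cc F'[unfolded h_def t_def]]
  show ?thesis unfolding ins_def outs_def q_def by blast
qed

text \<open>\<open>P\<^sub>0\<close> may be small or even negative, while the input has to be read
  and the output written in any case; hence the maximum with 1. The constant depends on
  \<open>E\<close> only through a bound for its array names, and not on \<open>CEF\<close>.\<close>

theorem theorem4:
  fixes E :: com and CEF :: "nat \<Rightarrow> nat \<Rightarrow> rat \<Rightarrow> real"
  assumes "certifying_electrical_flow_algorithm E CEF"
  shows "\<exists>M :: com. \<exists>C :: real.
    \<forall>(n::nat) (m::nat) (G :: (nat, nat) pre_digraph)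
      (b :: rat vec) (c :: rat vec) (x :: rat vec) (y :: rat vec) (s :: rat vec) (P\<^sub>0 :: real).
      m \<ge> 1 \<and> numbered_digraph n m G \<and>
      interior_primal (incidence_mat n m G) b x \<and>
      interior_dual (incidence_mat n m G) c y s \<and>
      potential m (real_vec x) (real_vec s) = P\<^sub>0 \<longrightarrow>
      (\<exists>x' y' s' t.
         computes_in_time M
           (encode_digraph n m G @ list_of_vec b @ list_of_vec c
              @ list_of_vec x @ list_of_vec y @ list_of_vec s)
           (list_of_vec x' @ list_of_vec y' @ list_of_vec s') t \<and>
         interior_primal (incidence_mat n m G) b x' \<and>
         interior_dual (incidence_mat n m G) c y' s' \<and>
         x' \<bullet> s' < 1 \<and>
         real t \<le> C * (max 1 P\<^sub>0 * CEF n m (1 / (16 * (of_nat (potential_parameter m))\<^sup>2))))"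
proof -
  obtain K where "\<forall>a \<in> com_names E. a < K"
    using finite_com_names[of E] by (auto simp: finite_nat_set_iff_bounded)
  \<comment> \<open>The offset 4 puts the input array 0 and the output array 1 on the side of the
    subroutine even if K = 0.\<close>
  then have names: "com_names E \<subseteq> {..<K + 4}" by force
  show ?thesis
    by (rule exI[of _ "potential_reduction_algorithm K E"],
        rule exI[of _ "real (32769 * (5 + call_cost K + update_cost K) + init_cost K + output_cost K + 11)"],
        intro allI impI, elim conjE,
        rule potential_reduction_algorithm_correct[OF assms names _ _ _ _ _ refl]) simp_all
qed

end
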